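(* For each $m\in\mathbb{N}$, the property of $m$-comparison is separably determined for $\mathrm{Cu}$-semigroups.
   Context: A $\mathrm{Cu}$-semigroup is a positively ordered (commutative) monoid $S$ (partial order compatible with addition, $0\leq x$ for all $x$) such that: (O1) increasing sequences have suprema; (O2) every element is the supremum of a sequence $(x_n)_n$ with $x_n\ll x_{n+1}$; (O3) $x'\ll x$ and $y'\ll y$ imply $x'+y'\ll x+y$; (O4) $\sup_n(x_n+y_n)=\sup_n x_n+\sup_n y_n$ for increasing sequences. Here $x\ll y$ means: for every increasing sequence $(y_n)_n$ with $y\leq\sup_n y_n$ there is $n$ with $x\leq y_n$. A $\mathrm{Cu}$-morphism is an order-preserving monoid morphism that preserves suprema of increasing sequences and the relation $\ll$. A submonoid $H\subseteq S$ is a sub-$\mathrm{Cu}$-semigroup if it is a $\mathrm{Cu}$-semigroup with the induced order and the inclusion $H\to S$ is a $\mathrm{Cu}$-morphism. $S$ is separable if it has a countable subset $B$ such that every element of $S$ is the supremum of an increasing sequence in $B$. $\mathrm{Sep}(S)$ is the family of separable sub-$\mathrm{Cu}$-semigroups of $S$, ordered by inclusion; every countable directed subset $\mathcal{D}'$ has a supremum in $\mathrm{Sep}(S)$, namely the set of suprema in $S$ of increasing sequences in $\bigcup\mathcal{D}'$. A family $\mathcal{D}\subseteq\mathrm{Sep}(S)$ is a club if it is cofinal (every $T_0\in\mathrm{Sep}(S)$ is contained in some $T\in\mathcal{D}$) and $\sigma$-complete ($\sup\mathcal{D}'\in\mathcal{D}$ for every countable directed $\mathcal{D}'\subseteq\mathcal{D}$).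 A property $\mathcal{P}$ of $\mathrm{Cu}$-semigroups satisfies the Löwenheim-Skolem condition if for every $\mathrm{Cu}$-semigroup $S$ with $\mathcal{P}$ there is a club in $\mathrm{Sep}(S)$ all of whose members have $\mathcal{P}$. It is separably determined if it satisfies the Löwenheim-Skolem condition and passes to inductive limits (in the category of $\mathrm{Cu}$-semigroups and $\mathrm{Cu}$-morphisms, over arbitrary directed index sets). Write $x<_s y$ if $(n+1)x\leq ny$ for some $n\in\mathbb{N}$ ($\mathbb{N}$ includes $0$). $S$ has $m$-comparison if whenever $x,y_0,\ldots,y_m\in S$ satisfy $x<_s y_j$ for $j=0,\ldots,m$, then $x\leq y_0+\ldots+y_m$. *)

theory Defs
  imports "HOL-Algebra.FiniteProduct" "HOL-Library.Countable_Set"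
begin

text \<open>
  The monoids below are additive in the mathematical literature. The HOL-Algebra record
  is multiplicative, so \<open>x + y\<close>, \<open>0\<close> and \<open>n x\<close> appear as \<open>x \<otimes> y\<close>, \<open>\<one>\<close> and \<open>x [^] n\<close>.
\<close>

record 'a ordered_monoid = "'a monoid" +
  leq :: "'a \<Rightarrow> 'a \<Rightarrow> bool" (infixl "\<preceq>\<index>" 50)

locale positively_ordered_monoid = comm_monoid S for S :: "'a ordered_monoid" (structure) +
  assumes leq_refl: "reflp_on (carrier S) (leq S)"
    and leq_antisym: "antisymp_on (carrier S) (leq S)"
    and leq_trans: "transp_on (carrier S) (leq S)"
    and leq_mult: "\<lbrakk>x \<in> carrier S; y \<in> carrier S; z \<in> carrier S; x \<preceq> y\<rbrakk> \<Longrightarrow> x \<otimes> z \<preceq> y \<otimes> z"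
    and one_leq: "x \<in> carrier S \<Longrightarrow> \<one> \<preceq> x"

definition increasing_seq :: "'a ordered_monoid \<Rightarrow> (nat \<Rightarrow> 'a) \<Rightarrow> bool" where
  "increasing_seq S f \<longleftrightarrow> (\<forall>n. f n \<in> carrier S \<and> f n \<preceq>\<^bsub>S\<^esub> f (Suc n))"

definition is_seq_sup :: "'a ordered_monoid \<Rightarrow> (nat \<Rightarrow> 'a) \<Rightarrow> 'a \<Rightarrow> bool" where
  "is_seq_sup S f x \<longleftrightarrow> x \<in> carrier S \<and> (\<forall>n. f n \<preceq>\<^bsub>S\<^esub> x) \<and>
     (\<forall>z\<in>carrier S. (\<forall>n. f n \<preceq>\<^bsub>S\<^esub> z) \<longrightarrow> x \<preceq>\<^bsub>S\<^esub> z)"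

definition way_below :: "'a ordered_monoid \<Rightarrow> 'a \<Rightarrow> 'a \<Rightarrow> bool" (infixl "\<lless>\<index>" 50) where
  "x \<lless>\<^bsub>S\<^esub> y \<longleftrightarrow> x \<in> carrier S \<and> y \<in> carrier S \<and>
     (\<forall>f z. increasing_seq S f \<and> is_seq_sup S f z \<and> y \<preceq>\<^bsub>S\<^esub> z \<longrightarrow> (\<exists>n. x \<preceq>\<^bsub>S\<^esub> f n))"

locale Cu_semigroup = positively_ordered_monoid +
  assumes O1: "increasing_seq S f \<Longrightarrow> \<exists>x. is_seq_sup S f x"
    and O2: "x \<in> carrier S \<Longrightarrow> \<exists>f. (\<forall>n. f n \<lless> f (Suc n)) \<and> is_seq_sup S f x"
    and O3: "\<lbrakk>x' \<lless> x; y' \<lless> y\<rbrakk> \<Longrightarrow> x' \<otimes> y' \<lless> x \<otimes> y"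
    and O4: "\<lbrakk>increasing_seq S f; increasing_seq S g; is_seq_sup S f x; is_seq_sup S g y\<rbrakk>
      \<Longrightarrow> is_seq_sup S (\<lambda>n. f n \<otimes> g n) (x \<otimes> y)"

definition Cu_morphisms :: "'a ordered_monoid \<Rightarrow> 'b ordered_monoid \<Rightarrow> ('a \<Rightarrow> 'b) set" where
  "Cu_morphisms S T = {h \<in> hom S T. h \<one>\<^bsub>S\<^esub> = \<one>\<^bsub>T\<^esub> \<and>
     (\<forall>x\<in>carrier S. \<forall>y\<in>carrier S. x \<preceq>\<^bsub>S\<^esub> y \<longrightarrow> h x \<preceq>\<^bsub>T\<^esub> h y) \<and>
     (\<forall>f x. increasing_seq S f \<and> is_seq_sup S f x \<longrightarrow> is_seq_sup T (\<lambda>n. h (f n)) (h x)) \<and>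
     (\<forall>x y. x \<lless>\<^bsub>S\<^esub> y \<longrightarrow> h x \<lless>\<^bsub>T\<^esub> h y)}"

definition sub_Cu_semigroup :: "'a ordered_monoid \<Rightarrow> 'a set \<Rightarrow> bool" where
  "sub_Cu_semigroup S H \<longleftrightarrow> submonoid H S \<and> Cu_semigroup (S\<lparr>carrier := H\<rparr>) \<and>
     (\<lambda>x. x) \<in> Cu_morphisms (S\<lparr>carrier := H\<rparr>) S"

definition separable :: "'a ordered_monoid \<Rightarrow> bool" where
  "separable S \<longleftrightarrow> (\<exists>B. countable B \<and> B \<subseteq> carrier S \<and>
     (\<forall>x\<in>carrier S. \<exists>f. increasing_seq S f \<and> range f \<subseteq> B \<and> is_seq_sup S f x))"

definition Sep :: "'a ordered_monoid \<Rightarrow> 'a set set" where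
  "Sep S = {T. sub_Cu_semigroup S T \<and> separable (S\<lparr>carrier := T\<rparr>)}"

definition directed_on :: "'i set \<Rightarrow> ('i \<Rightarrow> 'i \<Rightarrow> bool) \<Rightarrow> bool" where
  "directed_on I r \<longleftrightarrow> I \<noteq> {} \<and> reflp_on I r \<and> transp_on I r \<and>
     (\<forall>i\<in>I. \<forall>j\<in>I. \<exists>k\<in>I. r i k \<and> r j k)"

definition is_Sep_sup :: "'a ordered_monoid \<Rightarrow> 'a set set \<Rightarrow> 'a set \<Rightarrow> bool" where
  "is_Sep_sup S D T \<longleftrightarrow> T \<in> Sep S \<and> (\<forall>E\<in>D. E \<subseteq> T) \<and>
     (\<forall>T'\<in>Sep S. (\<forall>E\<in>D. E \<subseteq> T') \<longrightarrow> T \<subseteq> T')"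

definition club :: "'a ordered_monoid \<Rightarrow> 'a set set \<Rightarrow> bool" where
  "club S D \<longleftrightarrow> D \<subseteq> Sep S \<and> (\<forall>T\<^sub>0\<in>Sep S. \<exists>T\<in>D. T\<^sub>0 \<subseteq> T) \<and>
     (\<forall>D'\<subseteq>D. countable D' \<and> directed_on D' (\<subseteq>) \<longrightarrow> (\<exists>T\<in>D. is_Sep_sup S D' T))"

definition Lowenheim_Skolem :: "('a ordered_monoid \<Rightarrow> bool) \<Rightarrow> bool" where
  "Lowenheim_Skolem P \<longleftrightarrow> (\<forall>S. Cu_semigroup S \<and> P S \<longrightarrow>
     (\<exists>D. club S D \<and> (\<forall>T\<in>D. P (S\<lparr>carrier := T\<rparr>))))"

definition Cu_system ::
  "'i set \<Rightarrow> ('i \<Rightarrow> 'i \<Rightarrow> bool) \<Rightarrow> ('i \<Rightarrow> 'a ordered_monoid) \<Rightarrow> ('i \<Rightarrow> 'i \<Rightarrow> 'a \<Rightarrow> 'a) \<Rightarrow> bool" where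
  "Cu_system I r G \<phi> \<longleftrightarrow> directed_on I r \<and> (\<forall>i\<in>I. Cu_semigroup (G i)) \<and>
     (\<forall>i\<in>I. \<forall>j\<in>I. r i j \<longrightarrow> \<phi> i j \<in> Cu_morphisms (G i) (G j)) \<and>
     (\<forall>i\<in>I. \<forall>x\<in>carrier (G i). \<phi> i i x = x) \<and>
     (\<forall>i\<in>I. \<forall>j\<in>I. \<forall>k\<in>I. r i j \<and> r j k \<longrightarrow> (\<forall>x\<in>carrier (G i). \<phi> j k (\<phi> i j x) = \<phi> i k x))"

definition Cu_cocone ::
  "'i set \<Rightarrow> ('i \<Rightarrow> 'i \<Rightarrow> bool) \<Rightarrow> ('i \<Rightarrow> 'a ordered_monoid) \<Rightarrow> ('i \<Rightarrow> 'i \<Rightarrow> 'a \<Rightarrow> 'a) \<Rightarrow>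
     'b ordered_monoid \<Rightarrow> ('i \<Rightarrow> 'a \<Rightarrow> 'b) \<Rightarrow> bool" where
  "Cu_cocone I r G \<phi> T \<tau> \<longleftrightarrow> Cu_semigroup T \<and> (\<forall>i\<in>I. \<tau> i \<in> Cu_morphisms (G i) T) \<and>
     (\<forall>i\<in>I. \<forall>j\<in>I. r i j \<longrightarrow> (\<forall>x\<in>carrier (G i). \<tau> j (\<phi> i j x) = \<tau> i x))"

text \<open>
  The universal property of an inductive limit. HOL cannot quantify over types inside a
  formula, so the test objects \<open>T\<close> have to live in a fixed type; we take \<open>('i \<times> 'a) set\<close>. This
  loses nothing. Some inductive limit \<open>L\<close> that is universal for test objects of every type has
  its elements in this type: represent the class of a \<open>\<lless>\<close>-increasing sequence \<open>(x\<^sub>n)\<close> with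
  \<open>x\<^sub>n \<in> G (i\<^sub>n)\<close> by the set of all \<open>(i, x)\<close> such that \<open>\<phi> i j x \<lless> \<phi> (i\<^sub>n) j (x\<^sub>n)\<close> in \<open>G j\<close> for some
  \<open>n\<close> and some \<open>j\<close> above \<open>i\<close> and \<open>i\<^sub>n\<close>. The candidate \<open>S\<close> itself also embeds in the type, via
  \<open>s \<mapsto> {(i, s)}\<close> for a fixed \<open>i\<close>. Testing \<open>S\<close> against these two objects gives an isomorphism
  of cocones \<open>S \<cong> L\<close>, so the property for this one test type implies it for all types.
\<close>

definition is_Cu_limit ::
  "'i set \<Rightarrow> ('i \<Rightarrow> 'i \<Rightarrow> bool) \<Rightarrow> ('i \<Rightarrow> 'a ordered_monoid) \<Rightarrow> ('i \<Rightarrow> 'i \<Rightarrow> 'a \<Rightarrow> 'a) \<Rightarrow>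
     'a ordered_monoid \<Rightarrow> ('i \<Rightarrow> 'a \<Rightarrow> 'a) \<Rightarrow> bool" where
  "is_Cu_limit I r G \<phi> S \<sigma> \<longleftrightarrow> Cu_cocone I r G \<phi> S \<sigma> \<and>
     (\<forall>(T :: ('i \<times> 'a) set ordered_monoid) \<tau>. Cu_cocone I r G \<phi> T \<tau> \<longrightarrow>
        (\<exists>u\<in>Cu_morphisms S T. (\<forall>i\<in>I. \<forall>x\<in>carrier (G i). u (\<sigma> i x) = \<tau> i x) \<and>
           (\<forall>v\<in>Cu_morphisms S T. (\<forall>i\<in>I. \<forall>x\<in>carrier (G i). v (\<sigma> i x) = \<tau> i x) \<longrightarrow>
              (\<forall>x\<in>carrier S. v x = u x))))"

text \<open>
  The members of a system and its limit share one type \<open>'a\<close>, since a HOL predicate \<open>P\<close> has only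
  one type; replacing \<open>'a\<close> by a disjoint sum accommodates any system together with its limit.
  The \<open>itself\<close> argument records the type of the index sets.
\<close>

definition passes_to_inductive_limits :: "'i itself \<Rightarrow> ('a ordered_monoid \<Rightarrow> bool) \<Rightarrow> bool" where
  "passes_to_inductive_limits _ P \<longleftrightarrow>
     (\<forall>(I :: 'i set) r G \<phi> S \<sigma>. Cu_system I r G \<phi> \<and> is_Cu_limit I r G \<phi> S \<sigma> \<and> (\<forall>i\<in>I. P (G i))
        \<longrightarrow> P S)"

definition separably_determined :: "'i itself \<Rightarrow> ('a ordered_monoid \<Rightarrow> bool) \<Rightarrow> bool" where
  "separably_determined i P \<longleftrightarrow> Lowenheim_Skolem P \<and> passes_to_inductive_limits i P"

definition stably_less :: "'a ordered_monoid \<Rightarrow> 'a \<Rightarrow> 'a \<Rightarrow> bool" where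
  "stably_less S x y \<longleftrightarrow> (\<exists>n::nat. x [^]\<^bsub>S\<^esub> (n + 1) \<preceq>\<^bsub>S\<^esub> y [^]\<^bsub>S\<^esub> n)"

definition m_comparison :: "nat \<Rightarrow> 'a ordered_monoid \<Rightarrow> bool" where
  "m_comparison m S \<longleftrightarrow> (\<forall>x\<in>carrier S. \<forall>y\<in>{..m} \<rightarrow> carrier S.
     (\<forall>j\<le>m. stably_less S x (y j)) \<longrightarrow> x \<preceq>\<^bsub>S\<^esub> (\<Otimes>\<^bsub>S\<^esub>j\<in>{..m}. y j))"

end

theory Submission
  imports Defs
begin

text \<open>
  The Loewenheim-Skolem condition holds with the largest possible club, all of \<open>Sep S\<close>:
  \<open>m\<close>-comparison speaks only of order and addition, so it is inherited by every sub-Cu-semigroup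
  (\<open>m_comparison_sub_Cu\<close>). What requires proof is that \<open>Sep S\<close> is \<open>\<sigma>\<close>-complete. The
  supremum of a countable directed family is the set of suprema of \<open>\<lless>\<close>-increasing sequences in
  its union. That such a closure is a sub-Cu-semigroup is a statement about arbitrary submonoids in
  which every element can be approximated from within (\<open>sub_Cu_way_below_closure\<close>); a diagonal
  argument gives closure under suprema.

  For an inductive limit \<open>S\<close> of \<open>(G i)\<close> with structure maps \<open>\<sigma> i\<close>, two facts are extracted
  from the universal property. First, the images of the \<open>\<sigma> i\<close> are dense: every element of \<open>S\<close> is
  the supremum of a \<open>\<lless>\<close>-increasing sequence of elements of these images (\<open>limit_dense\<close>).
  Their closure is a sub-Cu-semigroup by the result above, so it receives a map from \<open>S\<close>, and
  uniqueness identifies that map with the identity. Second, order relations in the limit are seen at a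
  finite stage: if \<open>\<sigma> i a \<preceq> \<sigma> i b\<close> and \<open>a' \<lless> a\<close>, then \<open>\<phi> i k a' \<lless> \<phi> i k b\<close> for some \<open>k\<close>
  (\<open>limit_reflects_order\<close>). For this \<open>S\<close> is mapped to a concrete cocone with the property, the
  completion by countably generated rounded ideals of the disjoint union of the \<open>G i\<close>.

  Now let \<open>(n\<^sub>j + 1) x \<preceq> n\<^sub>j y\<^sub>j\<close> in \<open>S\<close> for \<open>j \<le> m\<close>. Replacing \<open>x\<close> by something way below it
  and each \<open>y\<^sub>j\<close> by a member of an approximating sequence, all elements involved come from one
  \<open>G l\<close>; shrinking the first of them once more, the finitely many inequalities hold in one \<open>G t\<close>.
  Comparison in \<open>G t\<close>, pushed forward to \<open>S\<close>, bounds arbitrarily good approximations of \<open>x\<close> by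
  the sum of the \<open>y\<^sub>j\<close> (\<open>m_comparison_limit\<close>).
\<close>

section \<open>Order theory of Cu-semigroups\<close>

text \<open>
  Choose the next term of the chain above both the previous term and the next element of an
  enumeration of \<open>A\<close>. With \<open>R\<close> the way-below relation this is the diagonal argument behind
  closure under suprema.
\<close>

lemma countable_directed_cofinal_chain:
  assumes "countable A" "A \<noteq> {}"
    and dir: "\<And>a b. \<lbrakk>a \<in> A; b \<in> A\<rbrakk> \<Longrightarrow> \<exists>c\<in>A. R a c \<and> R b c"
  obtains f :: "nat \<Rightarrow> 'a" where "\<And>n. f n \<in> A" "\<And>n. R (f n) (f (Suc n))"
    "\<And>a. a \<in> A \<Longrightarrow> \<exists>n. R a (f n)"
proof -
  define e where "e = from_nat_into A"
  have e: "e n \<in> A" for n using assms(2) by (simp add: e_def from_nat_into)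
  obtain f where f: "\<And>n. f n \<in> A" "\<And>n. R (f n) (f (Suc n)) \<and> R (e n) (f (Suc n))"
  proof (rule dependent_nat_choice[of "\<lambda>_ a. a \<in> A" "\<lambda>n a c. R a c \<and> R (e n) c", THEN exE])
    show "\<exists>a. a \<in> A" using assms(2) by blast
    show "\<exists>c. c \<in> A \<and> R a c \<and> R (e n) c" if "a \<in> A" for a n using dir[OF that e] by blast
  qed blast
  have "\<exists>n. R a (f n)" if a: "a \<in> A" for a
  proof -
    obtain n where "a = e n"
      using assms(1) a unfolding e_def by (metis from_nat_into_surj)
    then show ?thesis using f(2) by blast
  qed
  with f that show thesis by blast
qed

context positively_ordered_monoid
begin

lemma le_refl: "x \<in> carrier S \<Longrightarrow> x \<preceq> x"
  using leq_refl by (auto dest: reflp_onD)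

lemma le_antisym: "\<lbrakk>x \<preceq> y; y \<preceq> x; x \<in> carrier S; y \<in> carrier S\<rbrakk> \<Longrightarrow> x = y"
  using leq_antisym by (auto dest: antisymp_onD)

lemma le_trans:
  "\<lbrakk>x \<preceq> y; y \<preceq> z; x \<in> carrier S; y \<in> carrier S; z \<in> carrier S\<rbrakk> \<Longrightarrow> x \<preceq> z"
  using leq_trans by (auto dest: transp_onD)

lemma mult_mono:
  assumes "x \<preceq> x'" "y \<preceq> y'" "x \<in> carrier S" "x' \<in> carrier S" "y \<in> carrier S" "y' \<in> carrier S"
  shows "x \<otimes> y \<preceq> x' \<otimes> y'"
proof (rule le_trans)
  show "x \<otimes> y \<preceq> x' \<otimes> y" using assms leq_mult by blast
  show "x' \<otimes> y \<preceq> x' \<otimes> y'" using assms leq_mult[of y y' x'] by (simp add: m_comm)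
qed (use assms in auto)

lemma finprod_mono:
  assumes "f \<in> {..m::nat} \<rightarrow> carrier S" "g \<in> {..m} \<rightarrow> carrier S" "\<And>j. j \<le> m \<Longrightarrow> f j \<preceq> g j"
  shows "finprod S f {..m} \<preceq> finprod S g {..m}"
  using assms
proof (induction m)
  case 0
  then show ?case by simp
next
  case (Suc m)
  have "f \<in> {..m} \<rightarrow> carrier S" "g \<in> {..m} \<rightarrow> carrier S" using Suc.prems by auto
  moreover have "f (Suc m) \<in> carrier S" "g (Suc m) \<in> carrier S" using Suc.prems by auto
  ultimately show ?case using Suc by (auto intro!: mult_mono)
qed

lemma increasing_seq_in: "increasing_seq S f \<Longrightarrow> f n \<in> carrier S"
  by (simp add: increasing_seq_def)

lemma increasing_seq_mono:
  assumes "increasing_seq S f" "m \<le> n" shows "f m \<preceq> f n"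
  using assms(2)
proof (induction n rule: dec_induct)
  case base
  show ?case using assms(1) by (simp add: increasing_seq_def le_refl)
next
  case (step n)
  then show ?case using assms(1) le_trans[of "f m" "f n" "f (Suc n)"]
    by (auto simp: increasing_seq_def)
qed

lemma seq_sup_in: "is_seq_sup S f x \<Longrightarrow> x \<in> carrier S"
  and seq_sup_upper: "is_seq_sup S f x \<Longrightarrow> f n \<preceq> x"
  and seq_sup_least: "\<lbrakk>is_seq_sup S f x; z \<in> carrier S; \<And>n. f n \<preceq> z\<rbrakk> \<Longrightarrow> x \<preceq> z"
  by (auto simp: is_seq_sup_def)

lemma seq_sup_unique: "\<lbrakk>is_seq_sup S f x; is_seq_sup S f y\<rbrakk> \<Longrightarrow> x = y"
  by (meson is_seq_sup_def le_antisym)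

lemma seq_sup_const: "x \<in> carrier S \<Longrightarrow> is_seq_sup S (\<lambda>_. x) x"
  by (simp add: is_seq_sup_def le_refl)

lemma increasing_seq_const: "x \<in> carrier S \<Longrightarrow> increasing_seq S (\<lambda>_. x)"
  by (simp add: increasing_seq_def le_refl)

lemma way_below_in: "x \<lless> y \<Longrightarrow> x \<in> carrier S" "x \<lless> y \<Longrightarrow> y \<in> carrier S"
  by (auto simp: way_below_def)

lemma way_belowD: "\<lbrakk>x \<lless> y; increasing_seq S f; is_seq_sup S f z; y \<preceq> z\<rbrakk> \<Longrightarrow> \<exists>n. x \<preceq> f n"
  by (auto simp: way_below_def)

lemma way_below_sup:
  assumes "x \<lless> y" "increasing_seq S f" "is_seq_sup S f y" shows "\<exists>n. x \<preceq> f n"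
  using way_belowD[OF assms] way_below_in[OF assms(1)] le_refl by blast

lemma way_below_imp_le: "x \<lless> y \<Longrightarrow> x \<preceq> y"
  using way_below_sup increasing_seq_const seq_sup_const way_below_in by blast

lemma le_way_below_trans:
  assumes "x \<preceq> y" "y \<lless> z" "x \<in> carrier S" shows "x \<lless> z"
  unfolding way_below_def
proof (intro conjI allI impI)
  fix f w assume *: "increasing_seq S f \<and> is_seq_sup S f w \<and> z \<preceq> w"
  then obtain n where "y \<preceq> f n" using way_belowD[OF assms(2)] by blast
  then have "x \<preceq> f n"
    using assms * by (meson le_trans increasing_seq_in way_below_in)
  then show "\<exists>n. x \<preceq> f n" by blast
qed (use assms way_below_in in auto)

lemma way_below_le_trans:
  assumes "x \<lless> y" "y \<preceq> z" "z \<in> carrier S" shows "x \<lless> z"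
  unfolding way_below_def
proof (intro conjI allI impI)
  fix f w assume *: "increasing_seq S f \<and> is_seq_sup S f w \<and> z \<preceq> w"
  then have "y \<preceq> w" using assms by (meson le_trans seq_sup_in way_below_in)
  then show "\<exists>n. x \<preceq> f n" using * assms(1) way_belowD by blast
qed (use assms way_below_in in auto)

lemma way_below_trans: "\<lbrakk>x \<lless> y; y \<lless> z\<rbrakk> \<Longrightarrow> x \<lless> z"
  by (meson way_below_imp_le le_way_below_trans way_below_in)

lemma way_below_chain_increasing: "(\<And>n. f n \<lless> f (Suc n)) \<Longrightarrow> increasing_seq S f"
  unfolding increasing_seq_def using way_below_imp_le way_below_in by blast

lemma way_below_chain_sup:
  "\<lbrakk>\<And>n. f n \<lless> f (Suc n); is_seq_sup S f x\<rbrakk> \<Longrightarrow> f n \<lless> x"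
  by (meson way_below_le_trans seq_sup_upper seq_sup_in)

lemma one_way_below: "x \<in> carrier S \<Longrightarrow> \<one> \<lless> x"
  by (simp add: way_below_def one_leq increasing_seq_in)

end

context Cu_semigroup
begin

lemma way_below_interpolate:
  assumes "x \<lless> y" obtains z where "x \<lless> z" "z \<lless> y"
proof -
  obtain f where f: "\<And>n. f n \<lless> f (Suc n)" "is_seq_sup S f y"
    using O2 way_below_in assms by blast
  then obtain n where "x \<preceq> f n"
    using way_below_sup[OF assms way_below_chain_increasing] by blast
  then have "x \<lless> f (Suc n)" using f(1) assms le_way_below_trans way_below_in by blast
  then show thesis using that way_below_chain_sup f by blast
qed

lemma way_below_sup_strict:
  assumes "x \<lless> y" "increasing_seq S f" "is_seq_sup S f y" shows "\<exists>n. x \<lless> f n"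
  by (meson assms way_below_interpolate way_below_sup way_below_le_trans increasing_seq_in)

lemma pow_way_below: "x \<lless> y \<Longrightarrow> x [^] (n::nat) \<lless> y [^] n"
  by (induction n) (auto intro: O3 one_way_below)

lemma pow_increasing:
  assumes "increasing_seq S f" shows "increasing_seq S (\<lambda>k. f k [^] (n::nat))"
proof -
  have "f k [^] n \<preceq> f (Suc k) [^] n" for k
    using assms by (induction n) (auto simp: increasing_seq_def intro: mult_mono le_refl)
  then show ?thesis using assms by (simp add: increasing_seq_def)
qed

lemma pow_seq_sup:
  assumes "increasing_seq S f" "is_seq_sup S f x"
  shows "is_seq_sup S (\<lambda>k. f k [^] (n::nat)) (x [^] n)"
proof (induction n)
  case 0
  then show ?case by (simp add: seq_sup_const)
next
  case (Suc n)
  then show ?case using O4[OF pow_increasing[OF assms(1)] assms(1) _ assms(2)] by simp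
qed

end

section \<open>Closures of submonoids under suprema\<close>

text \<open>
  Asking for \<open>\<lless>\<close>-increasing rather than merely increasing sequences makes (O2) for the closure
  immediate. When \<open>M\<close> is contained in its closure, increasing sequences in \<open>M\<close> have their suprema
  there as well, by the next lemma.
\<close>

definition way_below_closure :: "'a ordered_monoid \<Rightarrow> 'a set \<Rightarrow> 'a set" where
  "way_below_closure S M =
     {x. \<exists>f. range f \<subseteq> M \<and> (\<forall>n. f n \<lless>\<^bsub>S\<^esub> f (Suc n)) \<and> is_seq_sup S f x}"

context Cu_semigroup
begin

text \<open>
  If \<open>f n\<close> is the supremum of a \<open>\<lless>\<close>-increasing sequence \<open>g n\<close> in \<open>M\<close>, then each
  \<open>g n k\<close> is way below \<open>f n\<close>, hence way below some \<open>g N l\<close> for every \<open>N \<ge> n\<close>. So the countable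
  set of all \<open>g n k\<close> is directed for \<open>\<lless>\<close>, and a cofinal chain in it has supremum \<open>x\<close>.
\<close>

lemma way_below_closure_sup:
  assumes inc: "increasing_seq S f" and sup: "is_seq_sup S f x"
    and cl: "\<And>n. f n \<in> way_below_closure S M"
  shows "x \<in> way_below_closure S M"
proof -
  have "\<forall>n. \<exists>g. range g \<subseteq> M \<and> (\<forall>k. g k \<lless> g (Suc k)) \<and> is_seq_sup S g (f n)"
    using cl by (simp add: way_below_closure_def)
  then obtain g where gM: "\<And>n k. g n k \<in> M" and gw: "\<And>n k. g n k \<lless> g n (Suc k)"
    and gs: "\<And>n. is_seq_sup S (g n) (f n)"
    unfolding image_subset_iff choice_iff by blast
  define A where "A = range (\<lambda>(n, k). g n k)"
  have ginc: "increasing_seq S (g n)" for n using gw way_below_chain_increasing by blast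
  have step: "\<exists>l. g n k \<lless> g N l" if "n \<le> N" for n k N
  proof (rule way_below_sup_strict[OF _ ginc gs])
    show "g n k \<lless> f N"
      using way_below_chain_sup[OF gw gs] increasing_seq_mono[OF inc that] inc
        way_below_le_trans increasing_seq_in by blast
  qed
  have dir: "\<exists>c\<in>A. a \<lless> c \<and> b \<lless> c" if AB: "a \<in> A" "b \<in> A" for a b
  proof -
    obtain n k n' k' where ab: "a = g n k" "b = g n' k'" using AB unfolding A_def by fast
    define N where "N = max n n'"
    obtain l l' where l: "a \<lless> g N l" "b \<lless> g N l'" unfolding ab N_def using step
      by (meson max.cobounded1 max.cobounded2)
    have "g N l \<preceq> g N (max l l')" "g N l' \<preceq> g N (max l l')"
      using increasing_seq_mono[OF ginc] by auto
    then have "a \<lless> g N (max l l')" "b \<lless> g N (max l l')"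
      using l way_below_le_trans increasing_seq_in[OF ginc] by blast+
    then show ?thesis by (auto simp: A_def)
  qed
  have "countable A" "A \<noteq> {}" by (auto simp: A_def)
  then obtain h where h: "\<And>n. h n \<in> A" "\<And>n. h n \<lless> h (Suc n)"
      "\<And>a. a \<in> A \<Longrightarrow> \<exists>n. a \<lless> h n"
    using countable_directed_cofinal_chain[of A "(\<lless>)"] dir by metis
  have "h n \<preceq> x" for n
  proof -
    obtain p q where "h n = g p q" using h(1)[of n] by (auto simp: A_def)
    then show ?thesis
      using seq_sup_upper[OF gs] seq_sup_upper[OF sup] le_trans seq_sup_in[OF sup]
        increasing_seq_in[OF inc] increasing_seq_in[OF ginc] by metis
  qed
  moreover have "x \<preceq> z" if "z \<in> carrier S" "\<And>n. h n \<preceq> z" for z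
  proof (intro seq_sup_least[OF sup] seq_sup_least[OF gs] that(1))
    fix p q
    obtain n where "g p q \<lless> h n" using h(3) by (auto simp: A_def)
    then show "g p q \<preceq> z" using that le_trans way_below_imp_le way_below_in by meson
  qed
  ultimately have "is_seq_sup S h x" using seq_sup_in[OF sup] by (simp add: is_seq_sup_def)
  moreover have "range h \<subseteq> M" using h(1) gM unfolding A_def by (metis (no_types, lifting) image_iff image_subset_iff case_prod_beta)
  ultimately show ?thesis using h(2) by (auto simp: way_below_closure_def)
qed

text \<open>
  The closure is stable under suprema taken in \<open>S\<close>, so suprema in the closure and in \<open>S\<close> agree.
  The way-below relations agree as well: if \<open>x\<close> is way below \<open>y\<close> in the closure, then \<open>x\<close> lies
  under a term of a \<open>\<lless>\<close>-increasing sequence with supremum \<open>y\<close>, and that term is way below \<open>y\<close>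
  in \<open>S\<close>. After these two comparisons the axioms are restrictions of those of \<open>S\<close>.
\<close>

lemma sub_Cu_way_below_closure:
  assumes M: "submonoid M S" and cl: "M \<subseteq> way_below_closure S M"
  shows "sub_Cu_semigroup S (way_below_closure S M)"
proof -
  define H where "H = way_below_closure S M"
  let ?H = "S\<lparr>carrier := H\<rparr>"
  have HS: "H \<subseteq> carrier S" by (auto simp: H_def way_below_closure_def is_seq_sup_def)
  have H1: "\<one> \<in> H" using submonoid.one_closed[OF M] cl by (auto simp: H_def)
  have Hm: "x \<otimes> y \<in> H" if "x \<in> H" "y \<in> H" for x y
  proof -
    obtain f where f: "range f \<subseteq> M" "\<And>n. f n \<lless> f (Suc n)" "is_seq_sup S f x"
      using \<open>x \<in> H\<close> unfolding H_def way_below_closure_def by blast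
    obtain g where g: "range g \<subseteq> M" "\<And>n. g n \<lless> g (Suc n)" "is_seq_sup S g y"
      using \<open>y \<in> H\<close> unfolding H_def way_below_closure_def by blast
    have "range (\<lambda>n. f n \<otimes> g n) \<subseteq> M"
      using f(1) g(1) submonoid.m_closed[OF M] by (simp add: image_subset_iff)
    moreover have "f n \<otimes> g n \<lless> f (Suc n) \<otimes> g (Suc n)" for n using f(2) g(2) O3 by blast
    moreover have "is_seq_sup S (\<lambda>n. f n \<otimes> g n) (x \<otimes> y)"
      using O4 way_below_chain_increasing f(2,3) g(2,3) by blast
    ultimately show ?thesis unfolding H_def way_below_closure_def by blast
  qed
  have sm: "submonoid H S" using HS H1 Hm by (simp add: submonoid_def)
  have incH: "increasing_seq ?H f \<longleftrightarrow> increasing_seq S f \<and> range f \<subseteq> H" for f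
    using HS by (auto simp: increasing_seq_def)
  have sup_in: "x \<in> H" if inc: "increasing_seq ?H f" and sup: "is_seq_sup S f x" for f x
  proof -
    have "f n \<in> way_below_closure S M" for n using inc incH by (auto simp: H_def)
    then show ?thesis using way_below_closure_sup[of f x M] inc sup incH H_def by blast
  qed
  have supH: "increasing_seq ?H f \<Longrightarrow> is_seq_sup ?H f x \<longleftrightarrow> is_seq_sup S f x" for f x
  proof
    assume inc: "increasing_seq ?H f" and x: "is_seq_sup ?H f x"
    obtain y where y: "is_seq_sup S f y" using O1 inc incH by blast
    then have "is_seq_sup ?H f y" using sup_in[OF inc y] HS by (auto simp: is_seq_sup_def)
    then have "x = y" using x y HS unfolding is_seq_sup_def
      by (auto intro!: le_antisym)
    then show "is_seq_sup S f x" using y by simp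
  next
    assume inc: "increasing_seq ?H f" and "is_seq_sup S f x"
    then show "is_seq_sup ?H f x" using sup_in[OF inc] HS by (auto simp: is_seq_sup_def)
  qed
  have wbH: "x \<lless>\<^bsub>?H\<^esub> y \<longleftrightarrow> x \<in> H \<and> y \<in> H \<and> x \<lless> y" for x y
  proof
    assume xy: "x \<in> H \<and> y \<in> H \<and> x \<lless> y"
    have "\<exists>n. x \<preceq> f n" if f: "increasing_seq ?H f" and z: "is_seq_sup ?H f z" "y \<preceq> z" for f z
    proof (rule way_belowD)
      show "increasing_seq S f" using f incH by simp
      show "is_seq_sup S f z" using supH[OF f] z(1) by simp
    qed (use xy z(2) in auto)
    then show "x \<lless>\<^bsub>?H\<^esub> y" using xy unfolding way_below_def by auto
  next
    assume w: "x \<lless>\<^bsub>?H\<^esub> y"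
    then have xy: "x \<in> H" "y \<in> H" by (auto simp: way_below_def)
    obtain f where f: "range f \<subseteq> M" "\<And>n. f n \<lless> f (Suc n)" "is_seq_sup S f y"
      using xy(2) by (auto simp: H_def way_below_closure_def)
    have "increasing_seq S f" using f(2) by (rule way_below_chain_increasing)
    then have inc: "increasing_seq ?H f" using f(1) cl incH[of f] by (auto simp: H_def)
    moreover have "y \<preceq>\<^bsub>?H\<^esub> y" using xy HS le_refl by auto
    moreover have "is_seq_sup ?H f y" using supH[OF inc] f(3) by simp
    ultimately obtain n where "x \<preceq>\<^bsub>?H\<^esub> f n"
      using w unfolding way_below_def by blast
    then have "x \<preceq> f n" by simp
    then have "x \<lless> y"
      using le_way_below_trans way_below_chain_sup[OF f(2,3)] xy HS by blast
    then show "x \<in> H \<and> y \<in> H \<and> x \<lless> y" using xy by simp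
  qed
  have "Cu_semigroup ?H"
  proof (intro Cu_semigroup.intro positively_ordered_monoid.intro
      positively_ordered_monoid_axioms.intro Cu_semigroup_axioms.intro)
    show "comm_monoid ?H"
      using HS H1 Hm by unfold_locales (auto simp: m_assoc subset_iff intro: m_comm)
    show "reflp_on (carrier ?H) (leq ?H)" using HS le_refl by (auto intro!: reflp_onI)
    show "antisymp_on (carrier ?H) (leq ?H)"
      using leq_antisym HS by (simp add: antisymp_on_subset)
    show "transp_on (carrier ?H) (leq ?H)"
      using leq_trans HS by (simp add: transp_on_subset)
  next
    fix x y z assume "x \<in> carrier ?H" "y \<in> carrier ?H" "z \<in> carrier ?H" "x \<preceq>\<^bsub>?H\<^esub> y"
    then show "x \<otimes>\<^bsub>?H\<^esub> z \<preceq>\<^bsub>?H\<^esub> y \<otimes>\<^bsub>?H\<^esub> z" using HS leq_mult[of x y z] by (simp add: subset_iff)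
  next
    fix x assume "x \<in> carrier ?H"
    then show "\<one>\<^bsub>?H\<^esub> \<preceq>\<^bsub>?H\<^esub> x" using HS one_leq[of x] by (simp add: subset_iff)
  next
    fix f assume "increasing_seq ?H f"
    then show "\<exists>x. is_seq_sup ?H f x" using O1 supH[of f] incH[of f] by blast
  next
    fix x assume "x \<in> carrier ?H"
    then obtain f where f: "range f \<subseteq> M" "\<And>n. f n \<lless> f (Suc n)" "is_seq_sup S f x"
      by (auto simp: H_def way_below_closure_def)
    have "increasing_seq S f" using f(2) by (rule way_below_chain_increasing)
    then have "increasing_seq ?H f" using f(1) cl incH[of f] by (auto simp: H_def)
    then have "is_seq_sup ?H f x" "\<And>n. f n \<in> H"
      using supH[of f] f(3) incH[of f] by auto
    then show "\<exists>f. (\<forall>n. f n \<lless>\<^bsub>?H\<^esub> f (Suc n)) \<and> is_seq_sup ?H f x"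
      using f(2) by (intro exI[of _ f]) (simp add: wbH)
  next
    fix x' x y' y assume "x' \<lless>\<^bsub>?H\<^esub> x" "y' \<lless>\<^bsub>?H\<^esub> y"
    then show "x' \<otimes>\<^bsub>?H\<^esub> y' \<lless>\<^bsub>?H\<^esub> x \<otimes>\<^bsub>?H\<^esub> y" using O3[of x' x y' y] Hm by (simp add: wbH)
  next
    fix f g x y
    assume fg: "increasing_seq ?H f" "increasing_seq ?H g" "is_seq_sup ?H f x" "is_seq_sup ?H g y"
    then have "increasing_seq ?H (\<lambda>n. f n \<otimes> g n)"
      using Hm HS by (auto simp: increasing_seq_def subset_iff intro!: mult_mono)
    moreover have "is_seq_sup S (\<lambda>n. f n \<otimes> g n) (x \<otimes> y)"
      using fg O4[of f g x y] supH[of f] supH[of g] incH[of f] incH[of g] by blast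
    ultimately show "is_seq_sup ?H (\<lambda>n. f n \<otimes>\<^bsub>?H\<^esub> g n) (x \<otimes>\<^bsub>?H\<^esub> y)" using supH by simp
  qed
  moreover have "(\<lambda>x. x) \<in> Cu_morphisms ?H S"
    using HS supH wbH by (auto simp: Cu_morphisms_def hom_def)
  ultimately show ?thesis using sm by (simp add: sub_Cu_semigroup_def H_def)
qed

end

lemma sub_Cu_semigroupD:
  assumes "sub_Cu_semigroup S H"
  shows "submonoid H S" "Cu_semigroup (S\<lparr>carrier := H\<rparr>)"
    "\<And>f x. \<lbrakk>increasing_seq (S\<lparr>carrier := H\<rparr>) f; is_seq_sup (S\<lparr>carrier := H\<rparr>) f x\<rbrakk> \<Longrightarrow> is_seq_sup S f x"
    "\<And>x y. x \<lless>\<^bsub>S\<lparr>carrier := H\<rparr>\<^esub> y \<Longrightarrow> x \<lless>\<^bsub>S\<^esub> y"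
  using assms by (auto simp: sub_Cu_semigroup_def Cu_morphisms_def)

lemma directed_Union_submonoid:
  assumes "directed_on \<D> (\<subseteq>)" "\<And>E. E \<in> \<D> \<Longrightarrow> submonoid E S"
  shows "submonoid (\<Union>\<D>) S"
proof (rule submonoid.intro)
  show "\<Union>\<D> \<subseteq> carrier S" using assms(2) submonoid.subset by blast
  show "\<one>\<^bsub>S\<^esub> \<in> \<Union>\<D>"
    using assms submonoid.one_closed unfolding directed_on_def by blast
  fix x y assume "x \<in> \<Union>\<D>" "y \<in> \<Union>\<D>"
  then obtain E where "E \<in> \<D>" "x \<in> E" "y \<in> E"
    using assms(1) unfolding directed_on_def by blast
  then show "x \<otimes>\<^bsub>S\<^esub> y \<in> \<Union>\<D>" using submonoid.m_closed[OF assms(2), of E x y] by blast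
qed

lemma sub_Cu_subset_way_below_closure:
  assumes "sub_Cu_semigroup S E" shows "E \<subseteq> way_below_closure S E"
proof
  fix x assume "x \<in> E"
  note E = sub_Cu_semigroupD[OF assms]
  interpret E: Cu_semigroup "S\<lparr>carrier := E\<rparr>" by (rule E(2))
  obtain f where f: "\<And>n. f n \<lless>\<^bsub>S\<lparr>carrier := E\<rparr>\<^esub> f (Suc n)" "is_seq_sup (S\<lparr>carrier := E\<rparr>) f x"
    using E.O2[of x] \<open>x \<in> E\<close> by auto
  have "range f \<subseteq> E" using E.way_below_in[OF f(1)] by auto
  then show "x \<in> way_below_closure S E"
    using f E(3)[OF E.way_below_chain_increasing] E(4) unfolding way_below_closure_def by blast
qed

lemma way_below_closure_mono: "M \<subseteq> N \<Longrightarrow> way_below_closure S M \<subseteq> way_below_closure S N"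
  unfolding way_below_closure_def by blast

text \<open>
  The union of countable dense subsets of the members is dense in the closure: between two consecutive
  terms of a \<open>\<lless>\<close>-increasing sequence in \<open>\<Union>\<D>\<close> there is room for an element of the
  dense subset of a member containing the larger term.
\<close>

lemma (in Cu_semigroup) separable_way_below_closure_Union:
  assumes sub: "sub_Cu_semigroup S (way_below_closure S (\<Union>\<D>))"
    and cl: "\<Union>\<D> \<subseteq> way_below_closure S (\<Union>\<D>)"
    and "countable \<D>" and Sep: "\<D> \<subseteq> Sep S"
  shows "separable (S\<lparr>carrier := way_below_closure S (\<Union>\<D>)\<rparr>)"
proof -
  let ?H = "S\<lparr>carrier := way_below_closure S (\<Union>\<D>)\<rparr>"
  have "\<forall>E\<in>\<D>. \<exists>B. countable B \<and> B \<subseteq> E \<and>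
      (\<forall>x\<in>E. \<exists>f. increasing_seq S f \<and> range f \<subseteq> B \<and> is_seq_sup S f x)"
  proof
    fix E assume "E \<in> \<D>"
    then have E: "sub_Cu_semigroup S E" "separable (S\<lparr>carrier := E\<rparr>)" using Sep unfolding Sep_def by blast+
    then obtain B where B: "countable B" "B \<subseteq> E" "\<And>x. x \<in> E \<Longrightarrow>
      \<exists>f. increasing_seq (S\<lparr>carrier := E\<rparr>) f \<and> range f \<subseteq> B \<and> is_seq_sup (S\<lparr>carrier := E\<rparr>) f x"
      unfolding separable_def by auto
    have "E \<subseteq> carrier S" using E(1) sub_Cu_semigroupD(1) submonoid.subset by blast
    then have "increasing_seq (S\<lparr>carrier := E\<rparr>) f \<Longrightarrow> increasing_seq S f" for f
      by (auto simp: increasing_seq_def)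
    then show "\<exists>B. countable B \<and> B \<subseteq> E \<and>
      (\<forall>x\<in>E. \<exists>f. increasing_seq S f \<and> range f \<subseteq> B \<and> is_seq_sup S f x)"
      using B sub_Cu_semigroupD(3)[OF E(1)] by meson
  qed
  then obtain B where B: "\<And>E. E \<in> \<D> \<Longrightarrow> countable (B E)" "\<And>E. E \<in> \<D> \<Longrightarrow> B E \<subseteq> E"
    "\<And>E x. \<lbrakk>E \<in> \<D>; x \<in> E\<rbrakk> \<Longrightarrow> \<exists>f. increasing_seq S f \<and> range f \<subseteq> B E \<and> is_seq_sup S f x"
    by metis
  have dense: "\<exists>f. increasing_seq ?H f \<and> range f \<subseteq> \<Union>(B ` \<D>) \<and> is_seq_sup ?H f x"
    if x: "x \<in> way_below_closure S (\<Union>\<D>)" for x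
  proof -
    obtain g where g: "range g \<subseteq> \<Union>\<D>" "\<And>n. g n \<lless> g (Suc n)" "is_seq_sup S g x"
      using x by (auto simp: way_below_closure_def)
    have "\<exists>c \<in> \<Union>(B ` \<D>). c \<in> carrier S \<and> g n \<preceq> c \<and> c \<preceq> g (Suc n)" for n
    proof -
      obtain E where E: "E \<in> \<D>" "g (Suc n) \<in> E" using g(1) by auto
      then obtain b where b: "increasing_seq S b" "range b \<subseteq> B E" "is_seq_sup S b (g (Suc n))"
        using B(3) by blast
      then obtain k where "g n \<preceq> b k" using way_below_sup[OF g(2)] by blast
      then show ?thesis
        using b E seq_sup_upper[OF b(3)] increasing_seq_in by blast
    qed
    then obtain c where c: "\<And>n. c n \<in> \<Union>(B ` \<D>)" "\<And>n. c n \<in> carrier S"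
      "\<And>n. g n \<preceq> c n" "\<And>n. c n \<preceq> g (Suc n)"
      by metis
    have gS: "g n \<in> carrier S" for n using g(2) way_below_in by blast
    have "c n \<preceq> c (Suc n)" for n using c gS le_trans by meson
    moreover have "c n \<in> way_below_closure S (\<Union>\<D>)" for n
      using c(1)[of n] B(2) cl by blast
    ultimately have "increasing_seq ?H c" by (simp add: increasing_seq_def)
    moreover have "is_seq_sup S c x"
      unfolding is_seq_sup_def
    proof (intro conjI allI ballI impI)
      show xS: "x \<in> carrier S" using g(3) seq_sup_in by blast
      show "c n \<preceq> x" for n
        using c(2,4) gS xS seq_sup_upper[OF g(3)] le_trans by meson
      show "x \<preceq> z" if "z \<in> carrier S" "\<forall>n. c n \<preceq> z" for z
        using seq_sup_least[OF g(3) that(1)] that c(2,3) gS le_trans by meson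
    qed
    then have "is_seq_sup ?H c x"
      using x submonoid.subset[OF sub_Cu_semigroupD(1)[OF sub]] by (auto simp: is_seq_sup_def)
    ultimately show ?thesis using c(1) by blast
  qed
  have "countable (\<Union>(B ` \<D>))" using \<open>countable \<D>\<close> B(1) by blast
  moreover have "\<Union>(B ` \<D>) \<subseteq> carrier ?H" using B(2) cl by auto
  ultimately show ?thesis
    unfolding separable_def
  proof (intro exI[of _ "\<Union>(B ` \<D>)"] conjI ballI)
    fix x assume "x \<in> carrier ?H"
    then have "x \<in> way_below_closure S (\<Union>\<D>)" by simp
    then show "\<exists>f. increasing_seq ?H f \<and> range f \<subseteq> \<Union>(B ` \<D>) \<and> is_seq_sup ?H f x"
      by (rule dense)
  qed
qed

text \<open>
  Minimality holds because a sub-Cu-semigroup containing \<open>\<Union>\<D>\<close> is closed under suprema of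
  increasing sequences.
\<close>

lemma (in Cu_semigroup) Sep_sup_way_below_closure:
  assumes Sep: "\<D> \<subseteq> Sep S" and "countable \<D>" and dir: "directed_on \<D> (\<subseteq>)"
  shows "is_Sep_sup S \<D> (way_below_closure S (\<Union>\<D>))"
proof -
  have subE: "sub_Cu_semigroup S E" if "E \<in> \<D>" for E using Sep that unfolding Sep_def by blast
  have cl: "\<Union>\<D> \<subseteq> way_below_closure S (\<Union>\<D>)"
  proof (rule Union_least)
    fix E assume "E \<in> \<D>"
    then have "E \<subseteq> way_below_closure S E" "E \<subseteq> \<Union>\<D>"
      using sub_Cu_subset_way_below_closure[OF subE] by auto
    then show "E \<subseteq> way_below_closure S (\<Union>\<D>)"
      using way_below_closure_mono[of E "\<Union>\<D>" S] by simp
  qed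
  have sub: "sub_Cu_semigroup S (way_below_closure S (\<Union>\<D>))"
  proof (rule sub_Cu_way_below_closure[OF _ cl])
    show "submonoid (\<Union>\<D>) S"
      by (rule directed_Union_submonoid[OF dir]) (rule sub_Cu_semigroupD(1)[OF subE])
  qed
  have "way_below_closure S (\<Union>\<D>) \<subseteq> T" if T_Sep: "T \<in> Sep S" and T_ub: "\<forall>E\<in>\<D>. E \<subseteq> T" for T
  proof
    fix x assume "x \<in> way_below_closure S (\<Union>\<D>)"
    then obtain f where f: "range f \<subseteq> \<Union>\<D>" "\<And>n. f n \<lless> f (Suc n)" "is_seq_sup S f x"
      by (auto simp: way_below_closure_def)
    have T: "sub_Cu_semigroup S T" using T_Sep unfolding Sep_def by blast
    interpret T: Cu_semigroup "S\<lparr>carrier := T\<rparr>" using sub_Cu_semigroupD(2)[OF T] .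
    have inc: "increasing_seq (S\<lparr>carrier := T\<rparr>) f"
      using f T_ub way_below_imp_le by (auto simp: increasing_seq_def)
    then obtain y where y: "is_seq_sup (S\<lparr>carrier := T\<rparr>) f y" using T.O1 by blast
    then have "y = x" using sub_Cu_semigroupD(3)[OF T inc] f(3) seq_sup_unique by blast
    then show "x \<in> T" using T.seq_sup_in[OF y] by simp
  qed
  moreover have "way_below_closure S (\<Union>\<D>) \<in> Sep S"
    using sub separable_way_below_closure_Union[OF sub cl \<open>countable \<D>\<close> Sep]
    unfolding Sep_def by blast
  ultimately show ?thesis using cl unfolding is_Sep_sup_def by blast
qed

lemma (in Cu_semigroup) club_Sep: "club S (Sep S)"
  unfolding club_def
proof (intro conjI ballI allI impI)
  fix \<D> assume "\<D> \<subseteq> Sep S" "countable \<D> \<and> directed_on \<D> (\<subseteq>)"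
  then have "is_Sep_sup S \<D> (way_below_closure S (\<Union>\<D>))"
    by (simp add: Sep_sup_way_below_closure)
  then show "\<exists>T\<in>Sep S. is_Sep_sup S \<D> T" unfolding is_Sep_sup_def by blast
qed auto

section \<open>Comparison in submonoids\<close>

lemma nat_pow_carrier_update: "x [^]\<^bsub>S\<lparr>carrier := H\<rparr>\<^esub> (n::nat) = x [^]\<^bsub>S\<^esub> n"
  by (induction n) auto

lemma finprod_submonoid:
  assumes "comm_monoid S" "comm_monoid (S\<lparr>carrier := H\<rparr>)" "H \<subseteq> carrier S" "y \<in> {..m::nat} \<rightarrow> H"
  shows "finprod (S\<lparr>carrier := H\<rparr>) y {..m} = finprod S y {..m}"
proof -
  interpret S: comm_monoid S by fact
  interpret H: comm_monoid "S\<lparr>carrier := H\<rparr>" by fact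
  show ?thesis using assms(3,4)
  proof (induction m)
    case 0
    then have "y 0 \<in> H" by auto
    then show ?case using 0 H.finprod_0[of y] S.finprod_0[of y] by (auto simp: subset_iff)
  next
    case (Suc m)
    then have "y \<in> {..Suc m} \<rightarrow> carrier S" "y \<in> {..m} \<rightarrow> H" by auto
    then show ?case using Suc H.finprod_Suc[of y m] S.finprod_Suc[of y m] by simp
  qed
qed

lemma m_comparison_sub_Cu:
  assumes "Cu_semigroup S" "m_comparison m S" "sub_Cu_semigroup S H"
  shows "m_comparison m (S\<lparr>carrier := H\<rparr>)"
proof -
  interpret S: Cu_semigroup S by fact
  interpret H: Cu_semigroup "S\<lparr>carrier := H\<rparr>" using assms(3) by (rule sub_Cu_semigroupD)
  have HS: "H \<subseteq> carrier S" using assms(3) sub_Cu_semigroupD(1) submonoid.subset by blast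
  show ?thesis
    unfolding m_comparison_def
  proof (intro ballI impI)
    fix x y assume x: "x \<in> carrier (S\<lparr>carrier := H\<rparr>)" and y: "y \<in> {..m} \<rightarrow> carrier (S\<lparr>carrier := H\<rparr>)"
      and less: "\<forall>j\<le>m. stably_less (S\<lparr>carrier := H\<rparr>) x (y j)"
    have "y \<in> {..m} \<rightarrow> carrier S" using y HS by auto
    moreover have "\<forall>j\<le>m. stably_less S x (y j)"
      using less by (simp add: stably_less_def nat_pow_carrier_update)
    ultimately have "x \<preceq>\<^bsub>S\<^esub> finprod S y {..m}"
      using assms(2) x HS unfolding m_comparison_def by auto
    then show "x \<preceq>\<^bsub>S\<lparr>carrier := H\<rparr>\<^esub> finprod (S\<lparr>carrier := H\<rparr>) y {..m}"
      using finprod_submonoid[OF S.comm_monoid_axioms H.comm_monoid_axioms HS] y by simp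
  qed
qed

lemma Lowenheim_Skolem_m_comparison: "Lowenheim_Skolem (m_comparison m)"
  unfolding Lowenheim_Skolem_def
proof (intro allI impI)
  fix S :: "'a ordered_monoid" assume S: "Cu_semigroup S \<and> m_comparison m S"
  then have "\<forall>T\<in>Sep S. m_comparison m (S\<lparr>carrier := T\<rparr>)"
    using m_comparison_sub_Cu by (auto simp: Sep_def)
  then show "\<exists>D. club S D \<and> (\<forall>T\<in>D. m_comparison m (S\<lparr>carrier := T\<rparr>))"
    using S Cu_semigroup.club_Sep by blast
qed

section \<open>Completion by countably generated rounded ideals\<close>

text \<open>
  An abstract form of the data from which an inductive limit is assembled: a set with an auxiliary
  relation \<open>\<lhd>\<close>, to be thought of as way-below, and an addition. The monoid laws are imposed only on
  the sets \<open>{w. w \<lhd> p}\<close>, because sums formed in different members of an inductive system agree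
  only after passing to a later member.
\<close>

locale rounded_basis =
  fixes P :: "'p set" and below :: "'p \<Rightarrow> 'p \<Rightarrow> bool" (infix "\<lhd>" 50)
    and add :: "'p \<Rightarrow> 'p \<Rightarrow> 'p" and zero :: 'p
  assumes below_in: "p \<lhd> q \<Longrightarrow> p \<in> P \<and> q \<in> P"
    and below_trans: "\<lbrakk>p \<lhd> q; q \<lhd> r\<rbrakk> \<Longrightarrow> p \<lhd> r"
    and rounded: "p \<in> P \<Longrightarrow>
      \<exists>s. (\<forall>n::nat. s n \<lhd> s (Suc n)) \<and> (\<forall>n. s n \<lhd> p) \<and> (\<forall>q. q \<lhd> p \<longrightarrow> (\<exists>n. q \<lhd> s n))"
    and add_mono: "\<lbrakk>p \<lhd> p'; q \<lhd> q'\<rbrakk> \<Longrightarrow> add p q \<lhd> add p' q'"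
    and add_commute: "\<lbrakk>w \<lhd> add p q; p \<in> P; q \<in> P\<rbrakk> \<Longrightarrow> w \<lhd> add q p"
    and add_assoc: "\<lbrakk>p \<in> P; q \<in> P; r \<in> P\<rbrakk> \<Longrightarrow> w \<lhd> add (add p q) r \<longleftrightarrow> w \<lhd> add p (add q r)"
    and zero_in: "zero \<in> P"
    and zero_below: "p \<in> P \<Longrightarrow> zero \<lhd> p"
    and add_zero: "p \<in> P \<Longrightarrow> w \<lhd> add zero p \<longleftrightarrow> w \<lhd> p"
begin

definition down :: "'p \<Rightarrow> 'p set" where "down p = {q. q \<lhd> p}"

text \<open>
  The rounded ideals that have a countable cofinal chain. The chain condition cannot be dropped: the
  \<open>\<lless>\<close>-increasing sequences required by (O2) come from it.
\<close>

definition ideals :: "'p set set" where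
  "ideals = {U. \<exists>s :: nat \<Rightarrow> 'p. (\<forall>n. s n \<lhd> s (Suc n)) \<and> U = (\<Union>n. down (s n))}"

text \<open>
  The ordered monoid of countably generated rounded ideals; the elements of a sum are those
  below a sum of two members.
\<close>

definition completion :: "'p set ordered_monoid" where
  "completion = \<lparr>carrier = ideals, mult = (\<lambda>U V. {w. \<exists>u\<in>U. \<exists>v\<in>V. w \<lhd> add u v}),
     one = down zero, leq = (\<subseteq>)\<rparr>"

lemma completion_simps [simp]:
  "carrier completion = ideals" "one completion = down zero" "leq completion = (\<subseteq>)"
  by (auto simp: completion_def)

lemma mult_completion: "mult completion U V = {w. \<exists>u\<in>U. \<exists>v\<in>V. w \<lhd> add u v}"
  by (auto simp: completion_def)

lemma chain_le:
  assumes "\<And>n. s n \<lhd> s (Suc n)" "m \<le> n" "p \<lhd> s m" shows "p \<lhd> s n"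
  using assms(2)
  by (induction n rule: dec_induct) (use assms(1,3) below_trans in blast)+

lemma ideal_down: "\<lbrakk>U \<in> ideals; u \<in> U; w \<lhd> u\<rbrakk> \<Longrightarrow> w \<in> U"
  unfolding ideals_def down_def using below_trans by blast

lemma ideal_subset: "U \<in> ideals \<Longrightarrow> U \<subseteq> P"
  unfolding ideals_def down_def using below_in by blast

lemma ideal_directed:
  assumes "U \<in> ideals" "u \<in> U" "v \<in> U" obtains w where "w \<in> U" "u \<lhd> w" "v \<lhd> w"
proof -
  obtain s where s: "\<And>n. s n \<lhd> s (Suc n)" "U = (\<Union>n. down (s n))"
    using assms(1) by (auto simp: ideals_def)
  obtain m n where "u \<lhd> s m" "v \<lhd> s n" using assms s(2) by (auto simp: down_def)
  then have "u \<lhd> s (max m n)" "v \<lhd> s (max m n)"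
    using chain_le[of s, OF s(1)] by (meson max.cobounded1 max.cobounded2)+
  moreover have "s (max m n) \<in> U" using s by (auto simp: down_def)
  ultimately show thesis using that by blast
qed

lemma ideal_above: "\<lbrakk>U \<in> ideals; u \<in> U\<rbrakk> \<Longrightarrow> \<exists>w\<in>U. u \<lhd> w"
  using ideal_directed by metis

lemma zero_in_ideal: "U \<in> ideals \<Longrightarrow> zero \<in> U"
  unfolding ideals_def down_def using below_in zero_below by blast

lemma idealI:
  assumes "countable A" "A \<noteq> {}" and dir: "\<And>a b. \<lbrakk>a \<in> A; b \<in> A\<rbrakk> \<Longrightarrow> \<exists>c\<in>A. a \<lhd> c \<and> b \<lhd> c"
  shows "(\<Union>a\<in>A. down a) \<in> ideals"
proof -
  obtain f where f: "\<And>n::nat. f n \<in> A" "\<And>n. f n \<lhd> f (Suc n)" "\<And>a. a \<in> A \<Longrightarrow> \<exists>n. a \<lhd> f n"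
    using countable_directed_cofinal_chain[of A "(\<lhd>)"] assms by metis
  have "(\<Union>a\<in>A. down a) = (\<Union>n. down (f n))"
  proof (intro equalityI subsetI)
    fix q assume "q \<in> (\<Union>a\<in>A. down a)"
    then obtain a where a: "a \<in> A" "q \<lhd> a" by (auto simp: down_def)
    obtain n where "a \<lhd> f n" using f(3)[OF a(1)] by blast
    then have "q \<lhd> f n" using a(2) by (rule below_trans[rotated])
    then show "q \<in> (\<Union>n. down (f n))" by (auto simp: down_def)
  qed (use f(1) in auto)
  then show ?thesis using f(2) unfolding ideals_def by blast
qed

lemma down_ideal: "p \<in> P \<Longrightarrow> down p \<in> ideals"
proof -
  assume "p \<in> P"
  then obtain s where s: "\<And>n::nat. s n \<lhd> s (Suc n)" "\<And>n. s n \<lhd> p" "\<And>q. q \<lhd> p \<Longrightarrow> \<exists>n. q \<lhd> s n"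
    using rounded by metis
  then have "down p = (\<Union>n. down (s n))" by (auto simp: down_def intro: below_trans)
  then show ?thesis using s(1) unfolding ideals_def by blast
qed

lemma in_down: "q \<in> down p \<longleftrightarrow> q \<lhd> p"
  by (simp add: down_def)

lemma down_mono: "p \<lhd> q \<Longrightarrow> down p \<subseteq> down q"
  by (auto simp: down_def intro: below_trans)

lemma down_subset: "\<lbrakk>U \<in> ideals; u \<in> U\<rbrakk> \<Longrightarrow> down u \<subseteq> U"
  using ideal_down by (auto simp: down_def)

lemma mult_ideals:
  assumes "U \<in> ideals" "V \<in> ideals" shows "mult completion U V \<in> ideals"
proof -
  obtain s where s: "\<And>n. s n \<lhd> s (Suc n)" "U = (\<Union>n. down (s n))"
    using assms(1) by (auto simp: ideals_def)
  obtain t where t: "\<And>n. t n \<lhd> t (Suc n)" "V = (\<Union>n. down (t n))"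
    using assms(2) by (auto simp: ideals_def)
  have "mult completion U V = (\<Union>n. down (add (s n) (t n)))"
  proof (intro equalityI subsetI)
    fix w assume "w \<in> mult completion U V"
    then obtain u v m n where *: "w \<lhd> add u v" "u \<lhd> s m" "v \<lhd> t n"
      using s t by (auto simp: mult_completion down_def)
    then have "u \<lhd> s (max m n)" "v \<lhd> t (max m n)"
      using chain_le[of s, OF s(1)] chain_le[of t, OF t(1)]
      by (meson max.cobounded1 max.cobounded2)+
    then have "w \<lhd> add (s (max m n)) (t (max m n))" using * add_mono below_trans by blast
    then show "w \<in> (\<Union>n. down (add (s n) (t n)))" by (auto simp: down_def)
  next
    fix w assume "w \<in> (\<Union>n. down (add (s n) (t n)))"
    then show "w \<in> mult completion U V"
      using s t unfolding mult_completion down_def by blast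
  qed
  moreover have "add (s n) (t n) \<lhd> add (s (Suc n)) (t (Suc n))" for n
    using s(1) t(1) add_mono by blast
  ultimately show ?thesis
    unfolding ideals_def by (intro CollectI exI[of _ "\<lambda>n. add (s n) (t n)"]) simp
qed

lemma add_in_mult:
  assumes "U \<in> ideals" "V \<in> ideals" "u \<in> U" "v \<in> V" shows "add u v \<in> mult completion U V"
  using ideal_above[OF assms(1,3)] ideal_above[OF assms(2,4)] add_mono
  unfolding mult_completion by blast

lemma increasing_completion:
  "increasing_seq completion F \<longleftrightarrow> (\<forall>n. F n \<in> ideals) \<and> (\<forall>n. F n \<subseteq> F (Suc n))"
  by (auto simp: increasing_seq_def)

lemma increasing_completion_le:
  "\<lbrakk>increasing_seq completion F; m \<le> n\<rbrakk> \<Longrightarrow> F m \<subseteq> F n"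
  unfolding increasing_completion by (metis lift_Suc_mono_le)

text \<open>
  Again a diagonal argument: the generating chains of all \<open>F n\<close> form one countable \<open>\<lhd>\<close>-directed
  set.
\<close>

lemma Union_ideal:
  assumes F: "increasing_seq completion F" shows "(\<Union>n. F n) \<in> ideals"
proof -
  have "\<forall>n. \<exists>s :: nat \<Rightarrow> 'p. (\<forall>k. s k \<lhd> s (Suc k)) \<and> F n = (\<Union>k. down (s k))"
    using F by (simp add: increasing_completion ideals_def)
  then obtain s :: "nat \<Rightarrow> nat \<Rightarrow> 'p" where s: "\<And>n k. s n k \<lhd> s n (Suc k)"
    "\<And>n. F n = (\<Union>k. down (s n k))"
    unfolding choice_iff by blast
  define A where "A = (\<Union>n. range (s n))"
  have FA: "(\<Union>n. F n) = (\<Union>a\<in>A. down a)" using s(2) by (auto simp: A_def)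
  have "A \<noteq> {}" "countable A" by (auto simp: A_def)
  moreover have "\<exists>c\<in>A. a \<lhd> c \<and> b \<lhd> c" if A: "a \<in> A" "b \<in> A" for a b
  proof -
    have mem: "s n k \<in> F n" for n k using s(1)[of n k] s(2)[of n] by (auto simp: down_def)
    then obtain m n where "a \<in> F m" "b \<in> F n" using A unfolding A_def by blast
    then have ab: "a \<in> F (max m n)" "b \<in> F (max m n)"
      using increasing_completion_le[OF F, of m "max m n"]
        increasing_completion_le[OF F, of n "max m n"] by auto
    have "F (max m n) \<in> ideals" using F by (simp add: increasing_completion)
    then obtain c where c: "c \<in> F (max m n)" "a \<lhd> c" "b \<lhd> c"
      using ideal_directed ab by metis
    obtain k where "c \<lhd> s (max m n) k" using c(1) s(2) by (auto simp: down_def)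
    then have "a \<lhd> s (max m n) k" "b \<lhd> s (max m n) k" using c below_trans by blast+
    then show ?thesis unfolding A_def by blast
  qed
  ultimately show ?thesis unfolding FA by (intro idealI)
qed

lemma seq_sup_completion:
  assumes "increasing_seq completion F"
  shows "is_seq_sup completion F U \<longleftrightarrow> U = (\<Union>n. F n)"
proof
  assume U: "is_seq_sup completion F U"
  then have "\<Union>(range F) \<subseteq> U" by (auto simp: is_seq_sup_def)
  moreover have "U \<subseteq> \<Union>(range F)"
    using U Union_ideal[OF assms] unfolding is_seq_sup_def by (simp add: UN_upper)
  ultimately show "U = (\<Union>n. F n)" by blast
next
  assume "U = (\<Union>n. F n)"
  then show "is_seq_sup completion F U"
    using Union_ideal[OF assms] by (auto simp: is_seq_sup_def)
qed

lemma ideal_principal_seq: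
  assumes "U \<in> ideals"
  obtains s where "\<And>n. s n \<lhd> s (Suc n)" "\<And>n. s n \<in> U"
    "increasing_seq completion (\<lambda>n. down (s n))" "U = (\<Union>n. down (s n))"
proof -
  obtain s where s: "\<And>n. s n \<lhd> s (Suc n)" "U = (\<Union>n. down (s n))"
    using assms by (auto simp: ideals_def)
  have "s n \<in> P" for n using s(1) below_in by blast
  then have "increasing_seq completion (\<lambda>n. down (s n))"
    using s(1) down_ideal unfolding increasing_completion
    by (simp add: down_mono)
  moreover have "s n \<in> U" for n using s(1)[of n] s(2) by (auto simp: down_def)
  ultimately show thesis using that s by blast
qed

text \<open>
  One direction tests the definition on the principal ideals of a chain generating \<open>V\<close>. In the
  other, an element \<open>v \<in> V\<close> with \<open>U \<subseteq> down v\<close> belongs to some member of any increasing sequence of ideals whose union contains \<open>V\<close>.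
\<close>

lemma way_below_completion:
  "U \<lless>\<^bsub>completion\<^esub> V \<longleftrightarrow> U \<in> ideals \<and> V \<in> ideals \<and> (\<exists>v\<in>V. U \<subseteq> down v)"
proof
  assume U: "U \<lless>\<^bsub>completion\<^esub> V"
  then have UV: "U \<in> ideals" "V \<in> ideals" by (auto simp: way_below_def)
  obtain s where s: "\<And>n. s n \<in> V"
    "increasing_seq completion (\<lambda>n. down (s n))" "V = (\<Union>n. down (s n))"
    using ideal_principal_seq[OF UV(2)] by metis
  have "is_seq_sup completion (\<lambda>n. down (s n)) V" using s seq_sup_completion by blast
  then obtain n where "U \<subseteq> down (s n)"
    using U s(2) unfolding way_below_def by auto
  then show "U \<in> ideals \<and> V \<in> ideals \<and> (\<exists>v\<in>V. U \<subseteq> down v)" using UV s(1) by blast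
next
  assume UV: "U \<in> ideals \<and> V \<in> ideals \<and> (\<exists>v\<in>V. U \<subseteq> down v)"
  then obtain v where v: "v \<in> V" "U \<subseteq> down v" by blast
  have "\<exists>n. U \<subseteq> F n" if F: "increasing_seq completion F" and W: "is_seq_sup completion F W" "V \<subseteq> W"
    for F W
  proof -
    obtain n where "v \<in> F n" using v W seq_sup_completion[OF F] by blast
    moreover have "F n \<in> ideals" using F by (simp add: increasing_completion)
    ultimately show ?thesis using v(2) down_subset by blast
  qed
  then show "U \<lless>\<^bsub>completion\<^esub> V" using UV unfolding way_below_def by auto
qed

lemma comm_monoid_completion: "comm_monoid completion"
proof (rule comm_monoidI)
  show "\<one>\<^bsub>completion\<^esub> \<in> carrier completion" using down_ideal zero_in by simp
next
  fix U V assume "U \<in> carrier completion" "V \<in> carrier completion"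
  then show "U \<otimes>\<^bsub>completion\<^esub> V \<in> carrier completion" using mult_ideals by simp
next
  fix U V assume "U \<in> carrier completion" "V \<in> carrier completion"
  then have "U \<subseteq> P" "V \<subseteq> P" using ideal_subset by auto
  then show "U \<otimes>\<^bsub>completion\<^esub> V = V \<otimes>\<^bsub>completion\<^esub> U"
    unfolding mult_completion using add_commute by blast
next
  fix U assume "U \<in> carrier completion"
  then have U: "U \<in> ideals" by simp
  show "\<one>\<^bsub>completion\<^esub> \<otimes>\<^bsub>completion\<^esub> U = U"
  proof (intro equalityI subsetI)
    fix w assume "w \<in> \<one>\<^bsub>completion\<^esub> \<otimes>\<^bsub>completion\<^esub> U"
    then obtain a u where a: "a \<lhd> zero" "u \<in> U" "w \<lhd> add a u"
      by (auto simp: mult_completion down_def)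
    obtain u' where u': "u' \<in> U" "u \<lhd> u'" using ideal_above[OF U a(2)] by blast
    then have "w \<lhd> add zero u'" using a add_mono below_trans by blast
    then have "w \<lhd> u'" using add_zero below_in u'(2) by blast
    then show "w \<in> U" using ideal_down[OF U u'(1)] by blast
  next
    fix w assume "w \<in> U"
    then obtain u where u: "u \<in> U" "w \<lhd> u" using ideal_above[OF U] by blast
    then have "w \<lhd> add zero u" using add_zero below_in by blast
    moreover have "zero \<in> down zero" using zero_below zero_in by (simp add: down_def)
    ultimately show "w \<in> \<one>\<^bsub>completion\<^esub> \<otimes>\<^bsub>completion\<^esub> U"
      using u unfolding mult_completion by auto
  qed
next
  fix U V W
  assume "U \<in> carrier completion" "V \<in> carrier completion" "W \<in> carrier completion"
  then have id: "U \<in> ideals" "V \<in> ideals" "W \<in> ideals" by auto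
  note sub = id[THEN ideal_subset]
  show "(U \<otimes>\<^bsub>completion\<^esub> V) \<otimes>\<^bsub>completion\<^esub> W = U \<otimes>\<^bsub>completion\<^esub> (V \<otimes>\<^bsub>completion\<^esub> W)"
  proof (intro equalityI subsetI)
    fix x assume "x \<in> (U \<otimes>\<^bsub>completion\<^esub> V) \<otimes>\<^bsub>completion\<^esub> W"
    then obtain a u v w where a: "u \<in> U" "v \<in> V" "a \<lhd> add u v" "w \<in> W" "x \<lhd> add a w"
      by (auto simp: mult_completion)
    obtain w' where w': "w' \<in> W" "w \<lhd> w'" using ideal_above[OF id(3) a(4)] by blast
    \<comment> \<open>Monotonicity of \<open>add\<close> needs strict steps in both arguments, so \<open>w\<close> is enlarged along with \<open>a\<close>.\<close>
    have "x \<lhd> add (add u v) w'" using a w' add_mono below_trans by blast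
    then have "x \<lhd> add u (add v w')" using add_assoc a w' sub by blast
    moreover have "add v w' \<in> V \<otimes>\<^bsub>completion\<^esub> W" using add_in_mult id a w' by blast
    ultimately show "x \<in> U \<otimes>\<^bsub>completion\<^esub> (V \<otimes>\<^bsub>completion\<^esub> W)"
      using a(1) unfolding mult_completion[of U] by blast
  next
    fix x assume "x \<in> U \<otimes>\<^bsub>completion\<^esub> (V \<otimes>\<^bsub>completion\<^esub> W)"
    then obtain a u v w where a: "u \<in> U" "v \<in> V" "a \<lhd> add v w" "w \<in> W" "x \<lhd> add u a"
      by (auto simp: mult_completion)
    obtain u' where u': "u' \<in> U" "u \<lhd> u'" using ideal_above[OF id(1) a(1)] by blast
    have "x \<lhd> add u' (add v w)" using a u' add_mono below_trans by blast
    then have "x \<lhd> add (add u' v) w" using add_assoc a u' sub by blast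
    moreover have "add u' v \<in> U \<otimes>\<^bsub>completion\<^esub> V" using add_in_mult id a u' by blast
    ultimately show "x \<in> (U \<otimes>\<^bsub>completion\<^esub> V) \<otimes>\<^bsub>completion\<^esub> W"
      using a(4) unfolding mult_completion[of _ W] by blast
  qed
qed

lemma mult_completion_mono:
  "\<lbrakk>U \<subseteq> U'; V \<subseteq> V'\<rbrakk> \<Longrightarrow> U \<otimes>\<^bsub>completion\<^esub> V \<subseteq> U' \<otimes>\<^bsub>completion\<^esub> V'"
  unfolding mult_completion by blast

lemma Cu_semigroup_completion: "Cu_semigroup completion"
proof (intro Cu_semigroup.intro positively_ordered_monoid.intro
    positively_ordered_monoid_axioms.intro Cu_semigroup_axioms.intro comm_monoid_completion)
  show "reflp_on (carrier completion) (leq completion)" by (auto intro: reflp_onI)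
  show "antisymp_on (carrier completion) (leq completion)" by (auto intro: antisymp_onI)
  show "transp_on (carrier completion) (leq completion)" by (auto intro: transp_onI)
next
  fix U V W assume "U \<preceq>\<^bsub>completion\<^esub> V"
  then show "U \<otimes>\<^bsub>completion\<^esub> W \<preceq>\<^bsub>completion\<^esub> V \<otimes>\<^bsub>completion\<^esub> W"
    using mult_completion_mono by simp
next
  fix U assume "U \<in> carrier completion"
  then show "\<one>\<^bsub>completion\<^esub> \<preceq>\<^bsub>completion\<^esub> U" using zero_in_ideal down_subset by simp
next
  fix F assume "increasing_seq completion F"
  then show "\<exists>U. is_seq_sup completion F U" using seq_sup_completion by blast
next
  fix U assume "U \<in> carrier completion"
  then have "U \<in> ideals" by simp
  then obtain s where s: "\<And>n. s n \<lhd> s (Suc n)" "\<And>n. s n \<in> U"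
    "increasing_seq completion (\<lambda>n. down (s n))" "U = (\<Union>n. down (s n))"
    using ideal_principal_seq by metis
  have "down (s n) \<lless>\<^bsub>completion\<^esub> down (s (Suc n))" for n
    using s(1)[of n] s(1)[of "Suc n"] s(3) unfolding way_below_completion increasing_completion
    by (auto intro!: bexI[of _ "s n"] simp: in_down)
  moreover have "is_seq_sup completion (\<lambda>n. down (s n)) U"
    using s(4) seq_sup_completion[OF s(3)] by simp
  ultimately show "\<exists>F. (\<forall>n. F n \<lless>\<^bsub>completion\<^esub> F (Suc n)) \<and> is_seq_sup completion F U"
    by (intro exI[of _ "\<lambda>n. down (s n)"]) simp
next
  fix U' U V' V assume "U' \<lless>\<^bsub>completion\<^esub> U" "V' \<lless>\<^bsub>completion\<^esub> V"
  then obtain u v where *: "U' \<in> ideals" "U \<in> ideals" "V' \<in> ideals" "V \<in> ideals"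
    "u \<in> U" "U' \<subseteq> down u" "v \<in> V" "V' \<subseteq> down v"
    unfolding way_below_completion by blast
  have "U' \<otimes>\<^bsub>completion\<^esub> V' \<subseteq> down (add u v)"
  proof
    fix w assume "w \<in> U' \<otimes>\<^bsub>completion\<^esub> V'"
    then obtain a b where "a \<lhd> u" "b \<lhd> v" "w \<lhd> add a b"
      using *(6,8) unfolding mult_completion subset_iff in_down by blast
    then show "w \<in> down (add u v)" using add_mono below_trans unfolding in_down by blast
  qed
  moreover have "add u v \<in> U \<otimes>\<^bsub>completion\<^esub> V" using * add_in_mult by blast
  ultimately show "U' \<otimes>\<^bsub>completion\<^esub> V' \<lless>\<^bsub>completion\<^esub> U \<otimes>\<^bsub>completion\<^esub> V"
    unfolding way_below_completion using *(1-4) mult_ideals by auto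
next
  fix F G U V
  assume F: "increasing_seq completion F" and G: "increasing_seq completion G"
    and U: "is_seq_sup completion F U" and V: "is_seq_sup completion G V"
  have inc: "increasing_seq completion (\<lambda>n. F n \<otimes>\<^bsub>completion\<^esub> G n)"
    using F G mult_ideals mult_completion_mono by (simp add: increasing_completion)
  have "U \<otimes>\<^bsub>completion\<^esub> V = (\<Union>n. F n \<otimes>\<^bsub>completion\<^esub> G n)"
  proof (intro equalityI subsetI)
    fix w assume "w \<in> U \<otimes>\<^bsub>completion\<^esub> V"
    then obtain u v m n where *: "u \<in> F m" "v \<in> G n" "w \<lhd> add u v"
      using U V seq_sup_completion[OF F] seq_sup_completion[OF G] by (auto simp: mult_completion)
    have "u \<in> F (max m n)" "v \<in> G (max m n)"
      using * increasing_completion_le[OF F, of m "max m n"]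
        increasing_completion_le[OF G, of n "max m n"] by auto
    then show "w \<in> (\<Union>n. F n \<otimes>\<^bsub>completion\<^esub> G n)" using *(3) by (auto simp: mult_completion)
  next
    fix w assume "w \<in> (\<Union>n. F n \<otimes>\<^bsub>completion\<^esub> G n)"
    then show "w \<in> U \<otimes>\<^bsub>completion\<^esub> V"
      using U V seq_sup_completion[OF F] seq_sup_completion[OF G]
      by (auto simp: mult_completion)
  qed
  then show "is_seq_sup completion (\<lambda>n. F n \<otimes>\<^bsub>completion\<^esub> G n) (U \<otimes>\<^bsub>completion\<^esub> V)"
    using seq_sup_completion[OF inc] by blast
qed

end

section \<open>Morphisms of Cu-semigroups\<close>

lemma Cu_morphismD:
  assumes "h \<in> Cu_morphisms S T"
  shows "\<And>x. x \<in> carrier S \<Longrightarrow> h x \<in> carrier T"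
    and "\<And>x y. \<lbrakk>x \<in> carrier S; y \<in> carrier S\<rbrakk> \<Longrightarrow> h (x \<otimes>\<^bsub>S\<^esub> y) = h x \<otimes>\<^bsub>T\<^esub> h y"
    and "h \<one>\<^bsub>S\<^esub> = \<one>\<^bsub>T\<^esub>"
    and "\<And>x y. \<lbrakk>x \<in> carrier S; y \<in> carrier S; x \<preceq>\<^bsub>S\<^esub> y\<rbrakk> \<Longrightarrow> h x \<preceq>\<^bsub>T\<^esub> h y"
    and "\<And>f x. \<lbrakk>increasing_seq S f; is_seq_sup S f x\<rbrakk> \<Longrightarrow> is_seq_sup T (\<lambda>n. h (f n)) (h x)"
    and "\<And>x y. x \<lless>\<^bsub>S\<^esub> y \<Longrightarrow> h x \<lless>\<^bsub>T\<^esub> h y"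
  using assms by (auto simp: Cu_morphisms_def hom_def)

lemma Cu_morphismI:
  assumes "\<And>x. x \<in> carrier S \<Longrightarrow> h x \<in> carrier T"
    and "\<And>x y. \<lbrakk>x \<in> carrier S; y \<in> carrier S\<rbrakk> \<Longrightarrow> h (x \<otimes>\<^bsub>S\<^esub> y) = h x \<otimes>\<^bsub>T\<^esub> h y"
    and "h \<one>\<^bsub>S\<^esub> = \<one>\<^bsub>T\<^esub>"
    and "\<And>x y. \<lbrakk>x \<in> carrier S; y \<in> carrier S; x \<preceq>\<^bsub>S\<^esub> y\<rbrakk> \<Longrightarrow> h x \<preceq>\<^bsub>T\<^esub> h y"
    and "\<And>f x. \<lbrakk>increasing_seq S f; is_seq_sup S f x\<rbrakk> \<Longrightarrow> is_seq_sup T (\<lambda>n. h (f n)) (h x)"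
    and "\<And>x y. x \<lless>\<^bsub>S\<^esub> y \<Longrightarrow> h x \<lless>\<^bsub>T\<^esub> h y"
  shows "h \<in> Cu_morphisms S T"
  using assms by (auto simp: Cu_morphisms_def hom_def)

lemma Cu_morphism_increasing_seq:
  assumes "h \<in> Cu_morphisms S T" "increasing_seq S f" shows "increasing_seq T (\<lambda>n. h (f n))"
  using assms(2) Cu_morphismD(1,4)[OF assms(1)] by (simp add: increasing_seq_def)

lemma Cu_morphism_comp:
  assumes g: "g \<in> Cu_morphisms S T" and h: "h \<in> Cu_morphisms T U"
  shows "(\<lambda>x. h (g x)) \<in> Cu_morphisms S U"
proof (rule Cu_morphismI)
  fix f x assume f: "increasing_seq S f" "is_seq_sup S f x"
  show "is_seq_sup U (\<lambda>n. h (g (f n))) (h (g x))"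
    using Cu_morphismD(5)[OF h Cu_morphism_increasing_seq[OF g f(1)] Cu_morphismD(5)[OF g f]] .
qed (simp_all add: Cu_morphismD[OF g] Cu_morphismD[OF h])

lemma Cu_morphism_pow:
  assumes "Cu_semigroup S" "h \<in> Cu_morphisms S T" "x \<in> carrier S"
  shows "h (x [^]\<^bsub>S\<^esub> (n::nat)) = h x [^]\<^bsub>T\<^esub> n"
proof -
  interpret Cu_semigroup S by fact
  show ?thesis
    by (induction n) (simp_all add: Cu_morphismD(2,3)[OF assms(2)] assms(3))
qed

lemma Cu_morphism_finprod:
  assumes S: "Cu_semigroup S" and T: "Cu_semigroup T" and h: "h \<in> Cu_morphisms S T"
    and "y \<in> {..m::nat} \<rightarrow> carrier S"
  shows "h (finprod S y {..m}) = finprod T (\<lambda>j. h (y j)) {..m}"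
proof -
  interpret S: Cu_semigroup S by fact
  interpret T: Cu_semigroup T by fact
  show ?thesis using assms(4)
  proof (induction m)
    case 0
    then have "y 0 \<in> carrier S" by auto
    then show ?case using Cu_morphismD(1)[OF h] by simp
  next
    case (Suc m)
    then have y: "y \<in> {..Suc m} \<rightarrow> carrier S" "y \<in> {..m} \<rightarrow> carrier S" "y (Suc m) \<in> carrier S"
      by auto
    then have "(\<lambda>j. h (y j)) \<in> {..Suc m} \<rightarrow> carrier T" using Cu_morphismD(1)[OF h] by auto
    then show ?case
      using Suc.IH[OF y(2)] y S.finprod_Suc[OF y(1)] T.finprod_Suc[of "\<lambda>j. h (y j)" m]
        Cu_morphismD(2)[OF h] by (simp add: S.finprod_closed)
  qed
qed

text \<open>
  Suprema are tested against all elements and way-below against all increasing sequences. In \<open>H\<close>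
  there are fewer tests, and they are also tests in \<open>T\<close>, because increasing sequences in \<open>H\<close> have
  the same suprema in \<open>T\<close>.
\<close>

lemma Cu_morphism_corestrict:
  assumes h: "h \<in> Cu_morphisms S T" and H: "sub_Cu_semigroup T H"
    and im: "\<And>x. x \<in> carrier S \<Longrightarrow> h x \<in> H" and S: "Cu_semigroup S"
  shows "h \<in> Cu_morphisms S (T\<lparr>carrier := H\<rparr>)"
proof -
  interpret S: Cu_semigroup S by fact
  have HT: "H \<subseteq> carrier T" using sub_Cu_semigroupD(1)[OF H] submonoid.subset by blast
  show ?thesis
  proof (rule Cu_morphismI)
    fix f x assume f: "increasing_seq S f" "is_seq_sup S f x"
    have "is_seq_sup T (\<lambda>n. h (f n)) (h x)" using Cu_morphismD(5)[OF h f] .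
    moreover have "h x \<in> H" using im S.seq_sup_in[OF f(2)] .
    ultimately show "is_seq_sup (T\<lparr>carrier := H\<rparr>) (\<lambda>n. h (f n)) (h x)"
      using HT by (auto simp: is_seq_sup_def)
  next
    fix x y assume xy: "x \<lless>\<^bsub>S\<^esub> y"
    then have "h x \<lless>\<^bsub>T\<^esub> h y" using Cu_morphismD(6)[OF h] by blast
    moreover have "increasing_seq T f" if "increasing_seq (T\<lparr>carrier := H\<rparr>) f" for f
      using that HT by (auto simp: increasing_seq_def)
    moreover have "h x \<in> H" "h y \<in> H" using im S.way_below_in[OF xy] by auto
    ultimately show "h x \<lless>\<^bsub>T\<lparr>carrier := H\<rparr>\<^esub> h y"
      using sub_Cu_semigroupD(3)[OF H] unfolding way_below_def by simp blast
  qed (use im Cu_morphismD(2-4)[OF h] in simp_all)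
qed

section \<open>Transport along an injection\<close>

text \<open>
  The copy of \<open>S\<close> carried by the image of \<open>e\<close>. The universal property of a limit tests against
  Cu-semigroups whose elements are subsets of \<open>'i \<times> 'a\<close>, so comparing the limit with itself requires
  a copy of it with elements of that kind.
\<close>

definition transport :: "('a \<Rightarrow> 'b) \<Rightarrow> 'a ordered_monoid \<Rightarrow> 'b ordered_monoid" where
  "transport e S = (let d = the_inv_into (carrier S) e in
     \<lparr>carrier = e ` carrier S, mult = (\<lambda>a b. e (d a \<otimes>\<^bsub>S\<^esub> d b)), one = e \<one>\<^bsub>S\<^esub>,
      leq = (\<lambda>a b. d a \<preceq>\<^bsub>S\<^esub> d b)\<rparr>)"

locale Cu_transport = Cu_semigroup S for S :: "'a ordered_monoid" (structure) +
  fixes e :: "'a \<Rightarrow> 'b"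
  assumes inj: "inj_on e (carrier S)"
begin

abbreviation "d \<equiv> the_inv_into (carrier S) e"
abbreviation "T \<equiv> transport e S"

lemma T_simps [simp]:
  "carrier T = e ` carrier S" "a \<otimes>\<^bsub>T\<^esub> b = e (d a \<otimes> d b)" "\<one>\<^bsub>T\<^esub> = e \<one>" "a \<preceq>\<^bsub>T\<^esub> b \<longleftrightarrow> d a \<preceq> d b"
  by (auto simp: transport_def Let_def)

lemma d_e [simp]: "x \<in> carrier S \<Longrightarrow> d (e x) = x"
  using inj by (simp add: the_inv_into_f_f)

lemma increasing_transport:
  "increasing_seq T f \<longleftrightarrow> (\<forall>n. f n \<in> e ` carrier S) \<and> increasing_seq S (\<lambda>n. d (f n))"
proof -
  have "d a \<in> carrier S" if "a \<in> e ` carrier S" for a using that by auto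
  then show ?thesis by (auto simp: increasing_seq_def)
qed

lemma seq_sup_transport:
  "is_seq_sup T f a \<longleftrightarrow> a \<in> e ` carrier S \<and> is_seq_sup S (\<lambda>n. d (f n)) (d a)"
  by (auto simp: is_seq_sup_def)

lemma way_below_transport:
  "a \<lless>\<^bsub>T\<^esub> b \<longleftrightarrow> a \<in> e ` carrier S \<and> b \<in> e ` carrier S \<and> d a \<lless> d b"
proof
  assume ab: "a \<lless>\<^bsub>T\<^esub> b"
  then have *: "a \<in> e ` carrier S" "b \<in> e ` carrier S" by (auto simp: way_below_def)
  have "\<exists>n. d a \<preceq> f n" if f: "increasing_seq S f" "is_seq_sup S f z" "d b \<preceq> z" for f z
  proof -
    have dn: "d (e (f n)) = f n" "f n \<in> carrier S" for n using increasing_seq_in[OF f(1)] by auto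
    have z: "z \<in> carrier S" using f(2) by (rule seq_sup_in)
    have "increasing_seq T (\<lambda>n. e (f n))" using f(1) dn by (simp add: increasing_transport)
    moreover have "is_seq_sup T (\<lambda>n. e (f n)) (e z)"
      using f(2) dn z by (simp add: seq_sup_transport)
    moreover have "b \<preceq>\<^bsub>T\<^esub> e z" using f(3) z by simp
    ultimately obtain n where "a \<preceq>\<^bsub>T\<^esub> e (f n)" using ab unfolding way_below_def by blast
    then show ?thesis using dn by auto
  qed
  then show "a \<in> e ` carrier S \<and> b \<in> e ` carrier S \<and> d a \<lless> d b"
    using * unfolding way_below_def by auto
next
  assume ab: "a \<in> e ` carrier S \<and> b \<in> e ` carrier S \<and> d a \<lless> d b"
  have "\<exists>n. d a \<preceq> d (f n)" if "increasing_seq T f" "is_seq_sup T f z" "d b \<preceq> d z" for f z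
    using ab that way_belowD[of "d a" "d b" "\<lambda>n. d (f n)" "d z"]
    by (simp add: increasing_transport seq_sup_transport)
  then show "a \<lless>\<^bsub>T\<^esub> b" using ab unfolding way_below_def by auto
qed

lemma Cu_semigroup_transport: "Cu_semigroup T"
proof (intro Cu_semigroup.intro positively_ordered_monoid.intro
    positively_ordered_monoid_axioms.intro Cu_semigroup_axioms.intro)
  show "comm_monoid T"
    by (rule comm_monoidI) (auto simp: m_assoc intro!: arg_cong[of _ _ e] m_comm)
  show "reflp_on (carrier T) (leq T)" by (auto intro!: reflp_onI le_refl)
  show "antisymp_on (carrier T) (leq T)" by (auto intro!: antisymp_onI arg_cong[of _ _ e] le_antisym)
  show "transp_on (carrier T) (leq T)" by (auto intro!: transp_onI intro: le_trans)
next
  fix x y z assume "x \<in> carrier T" "y \<in> carrier T" "z \<in> carrier T" "x \<preceq>\<^bsub>T\<^esub> y"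
  then show "x \<otimes>\<^bsub>T\<^esub> z \<preceq>\<^bsub>T\<^esub> y \<otimes>\<^bsub>T\<^esub> z" by (auto intro: leq_mult)
next
  fix x assume "x \<in> carrier T"
  then show "\<one>\<^bsub>T\<^esub> \<preceq>\<^bsub>T\<^esub> x" by (auto intro: one_leq)
next
  fix f assume "increasing_seq T f"
  then obtain x where "is_seq_sup S (\<lambda>n. d (f n)) x" using O1 increasing_transport by blast
  then have "is_seq_sup T f (e x)" using seq_sup_in by (auto simp: seq_sup_transport)
  then show "\<exists>x. is_seq_sup T f x" ..
next
  fix a assume "a \<in> carrier T"
  then obtain x where x: "x \<in> carrier S" "a = e x" by auto
  then obtain f where f: "\<And>n. f n \<lless> f (Suc n)" "is_seq_sup S f x" using O2 by blast
  have fS: "f n \<in> carrier S" for n using f(1) way_below_in by blast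
  have "e (f n) \<lless>\<^bsub>T\<^esub> e (f (Suc n))" for n using f(1) fS by (simp add: way_below_transport)
  moreover have "is_seq_sup T (\<lambda>n. e (f n)) a" using f(2) fS x by (simp add: seq_sup_transport)
  ultimately show "\<exists>f. (\<forall>n. f n \<lless>\<^bsub>T\<^esub> f (Suc n)) \<and> is_seq_sup T f a"
    by (intro exI[of _ "\<lambda>n. e (f n)"]) blast
next
  fix x' x y' y assume xy: "x' \<lless>\<^bsub>T\<^esub> x" "y' \<lless>\<^bsub>T\<^esub> y"
  then have "d x' \<otimes> d y' \<lless> d x \<otimes> d y" using O3 by (simp add: way_below_transport)
  then show "x' \<otimes>\<^bsub>T\<^esub> y' \<lless>\<^bsub>T\<^esub> x \<otimes>\<^bsub>T\<^esub> y"
    using way_below_in by (simp add: way_below_transport)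
next
  fix f g x y
  assume fg: "increasing_seq T f" "increasing_seq T g" "is_seq_sup T f x" "is_seq_sup T g y"
  then have *: "is_seq_sup S (\<lambda>n. d (f n) \<otimes> d (g n)) (d x \<otimes> d y)"
    using O4 by (simp add: increasing_transport seq_sup_transport)
  have "d (f n) \<in> carrier S" "d (g n) \<in> carrier S" for n
    using fg(1,2) increasing_seq_in unfolding increasing_transport by fast+
  then show "is_seq_sup T (\<lambda>n. f n \<otimes>\<^bsub>T\<^esub> g n) (x \<otimes>\<^bsub>T\<^esub> y)"
    using * seq_sup_in[OF *] by (simp add: seq_sup_transport)
qed

lemma transport_morphism: "e \<in> Cu_morphisms S T"
proof (rule Cu_morphismI)
  fix f x assume f: "increasing_seq S f" "is_seq_sup S f x"
  then show "is_seq_sup T (\<lambda>n. e (f n)) (e x)"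
    using increasing_seq_in[OF f(1)] seq_sup_in[OF f(2)] by (simp add: seq_sup_transport)
next
  fix x y assume "x \<lless> y"
  then show "e x \<lless>\<^bsub>T\<^esub> e y" using way_below_in by (simp add: way_below_transport)
qed auto

end

section \<open>The inductive limit as a completion\<close>

text \<open>
  The completion is applied to the disjoint union of the members of the system, where \<open>(i, x)\<close> is
  below \<open>(j, y)\<close> if the images of \<open>x\<close> and \<open>y\<close> in some later member are related by \<open>\<lless>\<close>. Since
  the connecting maps preserve \<open>\<lless>\<close>, the relation then persists in all later members.
\<close>

locale Cu_inductive_system =
  fixes I :: "'i set" and r :: "'i \<Rightarrow> 'i \<Rightarrow> bool"
    and G :: "'i \<Rightarrow> 'a ordered_monoid" and \<phi> :: "'i \<Rightarrow> 'i \<Rightarrow> 'a \<Rightarrow> 'a"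
  assumes system: "Cu_system I r G \<phi>"
begin

lemma r_refl: "i \<in> I \<Longrightarrow> r i i"
  using system by (auto simp: Cu_system_def directed_on_def dest: reflp_onD)

lemma r_trans: "\<lbrakk>r i j; r j k; i \<in> I; j \<in> I; k \<in> I\<rbrakk> \<Longrightarrow> r i k"
  using system unfolding Cu_system_def directed_on_def by (meson transp_onD)

lemma r_upper: "\<lbrakk>i \<in> I; j \<in> I\<rbrakk> \<Longrightarrow> \<exists>k\<in>I. r i k \<and> r j k"
  using system by (simp add: Cu_system_def directed_on_def)

lemma I_nonempty: "I \<noteq> {}"
  using system by (simp add: Cu_system_def directed_on_def)

lemma Cu_G: "i \<in> I \<Longrightarrow> Cu_semigroup (G i)"
  using system by (simp add: Cu_system_def)

lemma \<phi>_morphism: "\<lbrakk>i \<in> I; j \<in> I; r i j\<rbrakk> \<Longrightarrow> \<phi> i j \<in> Cu_morphisms (G i) (G j)"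
  using system by (simp add: Cu_system_def)

lemma \<phi>_id: "\<lbrakk>i \<in> I; x \<in> carrier (G i)\<rbrakk> \<Longrightarrow> \<phi> i i x = x"
  using system by (simp add: Cu_system_def)

lemma \<phi>_comp:
  "\<lbrakk>r i j; r j k; i \<in> I; j \<in> I; k \<in> I; x \<in> carrier (G i)\<rbrakk> \<Longrightarrow> \<phi> j k (\<phi> i j x) = \<phi> i k x"
  using system unfolding Cu_system_def by blast

lemma \<phi>_in: "\<lbrakk>i \<in> I; j \<in> I; r i j; x \<in> carrier (G i)\<rbrakk> \<Longrightarrow> \<phi> i j x \<in> carrier (G j)"
  using Cu_morphismD(1)[OF \<phi>_morphism] .

lemma \<phi>_mult:
  "\<lbrakk>i \<in> I; j \<in> I; r i j; x \<in> carrier (G i); y \<in> carrier (G i)\<rbrakk>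
    \<Longrightarrow> \<phi> i j (x \<otimes>\<^bsub>G i\<^esub> y) = \<phi> i j x \<otimes>\<^bsub>G j\<^esub> \<phi> i j y"
  using Cu_morphismD(2)[OF \<phi>_morphism] .

lemma finite_upper:
  assumes "finite J" "J \<subseteq> I" shows "\<exists>k\<in>I. \<forall>j\<in>J. r j k"
  using assms
proof (induction J)
  case empty
  then show ?case using I_nonempty by blast
next
  case (insert i J)
  then obtain k where k: "k \<in> I" "\<forall>j\<in>J. r j k" by blast
  obtain l where l: "l \<in> I" "r i l" "r k l" using r_upper[of i k] insert.prems k by blast
  have "r j l" if "j \<in> J" for j using r_trans[of j k l] that k l insert.prems by blast
  then show ?case using l by blast
qed

definition pairs :: "('i \<times> 'a) set" where "pairs = Sigma I (\<lambda>i. carrier (G i))"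

definition below :: "'i \<times> 'a \<Rightarrow> 'i \<times> 'a \<Rightarrow> bool" where
  "below p q \<longleftrightarrow> p \<in> pairs \<and> q \<in> pairs \<and>
     (\<exists>k\<in>I. r (fst p) k \<and> r (fst q) k \<and> \<phi> (fst p) k (snd p) \<lless>\<^bsub>G k\<^esub> \<phi> (fst q) k (snd q))"

lemma way_below_later:
  assumes "\<phi> i k x \<lless>\<^bsub>G k\<^esub> \<phi> j k y" "r i k" "r j k" "r k l" "i \<in> I" "j \<in> I" "k \<in> I" "l \<in> I"
    "x \<in> carrier (G i)" "y \<in> carrier (G j)"
  shows "\<phi> i l x \<lless>\<^bsub>G l\<^esub> \<phi> j l y"
  using Cu_morphismD(6)[OF \<phi>_morphism[of k l] assms(1)] assms \<phi>_comp[of i k l x] \<phi>_comp[of j k l y]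
  by simp

lemma belowI:
  "\<lbrakk>i \<in> I; j \<in> I; k \<in> I; x \<in> carrier (G i); y \<in> carrier (G j); r i k; r j k;
    \<phi> i k x \<lless>\<^bsub>G k\<^esub> \<phi> j k y\<rbrakk> \<Longrightarrow> below (i, x) (j, y)"
  by (auto simp: below_def pairs_def)

text \<open>
  The stage \<open>k\<close> can be taken above any prescribed index \<open>l\<close>, which allows relations from
  different stages to be combined.
\<close>

lemma belowE:
  assumes "below (i, x) (j, y)" "l \<in> I"
  obtains k where "i \<in> I" "j \<in> I" "k \<in> I" "x \<in> carrier (G i)" "y \<in> carrier (G j)"
    "r i k" "r j k" "r l k" "\<phi> i k x \<lless>\<^bsub>G k\<^esub> \<phi> j k y"
proof -
  obtain k where k: "i \<in> I" "j \<in> I" "k \<in> I" "x \<in> carrier (G i)" "y \<in> carrier (G j)"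
    "r i k" "r j k" "\<phi> i k x \<lless>\<^bsub>G k\<^esub> \<phi> j k y"
    using assms(1) by (auto simp: below_def pairs_def)
  obtain k' where k': "k' \<in> I" "r k k'" "r l k'" using r_upper[OF k(3) assms(2)] by blast
  show thesis
    by (rule that[of k']) (use k k' r_trans[of i k k'] r_trans[of j k k'] way_below_later in auto)
qed

lemma below_trans:
  assumes "below p q" "below q s" shows "below p s"
proof -
  obtain i x j y k z where [simp]: "p = (i, x)" "q = (j, y)" "s = (k, z)" by (metis surj_pair)
  have "j \<in> I" using assms by (simp add: below_def pairs_def)
  obtain a where a: "i \<in> I" "j \<in> I" "a \<in> I" "x \<in> carrier (G i)" "y \<in> carrier (G j)"
    "r i a" "r j a" "\<phi> i a x \<lless>\<^bsub>G a\<^esub> \<phi> j a y"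
    using belowE[of i x j y j] assms(1) \<open>j \<in> I\<close> by auto
  obtain b where b: "k \<in> I" "b \<in> I" "z \<in> carrier (G k)" "r j b" "r k b" "r a b"
    "\<phi> j b y \<lless>\<^bsub>G b\<^esub> \<phi> k b z"
    using belowE[of j y k z a] assms(2) a(3) by auto
  interpret Gb: Cu_semigroup "G b" using Cu_G b(2) .
  have "\<phi> i b x \<lless>\<^bsub>G b\<^esub> \<phi> j b y" using way_below_later[of a i x j y b] a b by blast
  then have "\<phi> i b x \<lless>\<^bsub>G b\<^esub> \<phi> k b z" using b(7) by (rule Gb.way_below_trans)
  then show ?thesis using a b r_trans[of i a b] by (auto intro!: belowI[of i k b])
qed

text \<open>
  Interpolation in \<open>G k\<close> supplies the strictness that turns \<open>\<lless>\<close> below a supremum into \<open>\<lless>\<close> below a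
  term. It yields both roundedness and the preservation of suprema by \<open>x \<mapsto> down (j, x)\<close>.
\<close>

lemma below_sup:
  assumes "below q (j, y)" and f: "increasing_seq (G j) f" "is_seq_sup (G j) f y"
  shows "\<exists>n. below q (j, f n)"
proof -
  obtain i x where [simp]: "q = (i, x)" by (metis surj_pair)
  have "j \<in> I" using assms by (simp add: below_def pairs_def)
  obtain k where k: "i \<in> I" "j \<in> I" "k \<in> I" "x \<in> carrier (G i)" "y \<in> carrier (G j)"
    "r i k" "r j k" "\<phi> i k x \<lless>\<^bsub>G k\<^esub> \<phi> j k y"
    using belowE[of i x j y j] assms(1) \<open>j \<in> I\<close> by auto
  interpret Gk: Cu_semigroup "G k" using Cu_G k(3) .
  interpret Gj: Cu_semigroup "G j" using Cu_G k(2) .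
  note \<phi>jk = \<phi>_morphism[OF k(2,3,7)]
  obtain n where "\<phi> i k x \<lless>\<^bsub>G k\<^esub> \<phi> j k (f n)"
    using Gk.way_below_sup_strict[OF k(8) Cu_morphism_increasing_seq[OF \<phi>jk f(1)]
        Cu_morphismD(5)[OF \<phi>jk f]] by blast
  then show ?thesis using k Gj.increasing_seq_in[OF f(1)] by (auto intro!: belowI[of i j k])
qed

lemma below_same_index:
  assumes "i \<in> I" "x \<lless>\<^bsub>G i\<^esub> y" shows "below (i, x) (i, y)"
proof -
  interpret Cu_semigroup "G i" using Cu_G assms(1) .
  show ?thesis using assms way_below_in[OF assms(2)] r_refl \<phi>_id by (auto intro!: belowI[of i i i])
qed

lemma below_rounded:
  assumes "p \<in> pairs"
  shows "\<exists>s. (\<forall>n::nat. below (s n) (s (Suc n))) \<and> (\<forall>n. below (s n) p) \<and>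
    (\<forall>q. below q p \<longrightarrow> (\<exists>n. below q (s n)))"
proof -
  obtain i x where p: "p = (i, x)" "i \<in> I" "x \<in> carrier (G i)" using assms by (auto simp: pairs_def)
  interpret Cu_semigroup "G i" using Cu_G p(2) .
  obtain f where f: "\<And>n. f n \<lless>\<^bsub>G i\<^esub> f (Suc n)" "is_seq_sup (G i) f x" using O2 p(3) by blast
  have inc: "increasing_seq (G i) f" using f(1) by (rule way_below_chain_increasing)
  show ?thesis
    using f below_same_index[OF p(2)] way_below_chain_sup[OF f] below_sup[OF _ inc f(2)]
    unfolding p(1) by (intro exI[of _ "\<lambda>n. (i, f n)"]) blast
qed

text \<open>
  Indistinguishable for \<open>below\<close>: such pairs generate the same principal ideal. Elements of different
  members that become equal later are equivalent.
\<close>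

definition equiv :: "'i \<times> 'a \<Rightarrow> 'i \<times> 'a \<Rightarrow> bool" where
  "equiv p q \<longleftrightarrow> (\<forall>w. (below w p \<longleftrightarrow> below w q) \<and> (below p w \<longleftrightarrow> below q w))"

lemma equivD:
  assumes "equiv p q" shows "below w p \<longleftrightarrow> below w q" "below p w \<longleftrightarrow> below q w"
  using assms unfolding equiv_def by blast+

lemma equiv_sym: "equiv p q \<Longrightarrow> equiv q p"
  and equiv_trans: "\<lbrakk>equiv p q; equiv q s\<rbrakk> \<Longrightarrow> equiv p s"
  by (auto simp: equiv_def)

lemma equiv_lift:
  assumes i: "i \<in> I" and k: "k \<in> I" and ik: "r i k" and x: "x \<in> carrier (G i)"
  shows "equiv (i, x) (k, \<phi> i k x)"
  unfolding equiv_def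
proof (intro allI conjI iffI)
  fix w :: "'i \<times> 'a"
  obtain j y where [simp]: "w = (j, y)" by (metis surj_pair)
  note xk = \<phi>_in[OF i k ik x]
  {
    assume "below w (i, x)"
    then obtain l where "j \<in> I" "l \<in> I" "y \<in> carrier (G j)" "r j l" "r i l" "r k l"
      "\<phi> j l y \<lless>\<^bsub>G l\<^esub> \<phi> i l x"
      using belowE[of j y i x k] k by auto
    then show "below w (k, \<phi> i k x)"
      using i k ik x xk \<phi>_comp[of i k l x] by (auto intro!: belowI[of j k l])
  next
    assume "below w (k, \<phi> i k x)"
    then obtain l where "j \<in> I" "l \<in> I" "y \<in> carrier (G j)" "r j l" "r k l" "r i l"
      "\<phi> j l y \<lless>\<^bsub>G l\<^esub> \<phi> k l (\<phi> i k x)"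
      using belowE[of j y k "\<phi> i k x" i] i by auto
    then show "below w (i, x)"
      using i k ik x \<phi>_comp[of i k l x] by (auto intro!: belowI[of j i l])
  next
    assume "below (i, x) w"
    then obtain l where "j \<in> I" "l \<in> I" "y \<in> carrier (G j)" "r j l" "r i l" "r k l"
      "\<phi> i l x \<lless>\<^bsub>G l\<^esub> \<phi> j l y"
      using belowE[of i x j y k] k by auto
    then show "below (k, \<phi> i k x) w"
      using i k ik x xk \<phi>_comp[of i k l x] by (auto intro!: belowI[of k j l])
  next
    assume "below (k, \<phi> i k x) w"
    then obtain l where "j \<in> I" "l \<in> I" "y \<in> carrier (G j)" "r j l" "r k l" "r i l"
      "\<phi> k l (\<phi> i k x) \<lless>\<^bsub>G l\<^esub> \<phi> j l y"
      using belowE[of k "\<phi> i k x" j y i] i by auto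
    then show "below (i, x) w"
      using i k ik x \<phi>_comp[of i k l x] by (auto intro!: belowI[of i j l])
  }
qed

definition upper :: "'i \<Rightarrow> 'i \<Rightarrow> 'i" where
  "upper i j = (SOME k. k \<in> I \<and> r i k \<and> r j k)"

lemma upper: "\<lbrakk>i \<in> I; j \<in> I\<rbrakk> \<Longrightarrow> upper i j \<in> I \<and> r i (upper i j) \<and> r j (upper i j)"
  unfolding upper_def by (rule someI_ex) (use r_upper in blast)

text \<open>
  The sum is formed at an arbitrarily chosen common index; by \<open>equiv_add\<close> any other common index gives
  an equivalent pair.
\<close>

definition add :: "'i \<times> 'a \<Rightarrow> 'i \<times> 'a \<Rightarrow> 'i \<times> 'a" where
  "add p q = (let k = upper (fst p) (fst q) in
     (k, \<phi> (fst p) k (snd p) \<otimes>\<^bsub>G k\<^esub> \<phi> (fst q) k (snd q)))"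

definition zero :: "'i \<times> 'a" where
  "zero = (let i = SOME i. i \<in> I in (i, \<one>\<^bsub>G i\<^esub>))"

lemma m_closed_G: "\<lbrakk>i \<in> I; x \<in> carrier (G i); y \<in> carrier (G i)\<rbrakk> \<Longrightarrow> x \<otimes>\<^bsub>G i\<^esub> y \<in> carrier (G i)"
proof -
  assume i: "i \<in> I" and xy: "x \<in> carrier (G i)" "y \<in> carrier (G i)"
  interpret Cu_semigroup "G i" using Cu_G i .
  show ?thesis using xy by simp
qed

lemma equiv_add:
  assumes i: "i \<in> I" "x \<in> carrier (G i)" and j: "j \<in> I" "y \<in> carrier (G j)"
    and k: "k \<in> I" "r i k" "r j k"
  shows "equiv (add (i, x) (j, y)) (k, \<phi> i k x \<otimes>\<^bsub>G k\<^esub> \<phi> j k y)"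
proof -
  have lift: "equiv (l, \<phi> i l x \<otimes>\<^bsub>G l\<^esub> \<phi> j l y) (m, \<phi> i m x \<otimes>\<^bsub>G m\<^esub> \<phi> j m y)"
    if l: "l \<in> I" "r i l" "r j l" and m: "m \<in> I" "r l m" for l m
  proof -
    have *: "\<phi> i l x \<in> carrier (G l)" "\<phi> j l y \<in> carrier (G l)" using i j l \<phi>_in by auto
    show ?thesis
      using equiv_lift[OF l(1) m(1) m(2) m_closed_G[OF l(1) *]] \<phi>_mult[OF l(1) m * ] l m i j
      by (simp add: \<phi>_comp)
  qed
  let ?l = "upper i j"
  have l: "?l \<in> I" "r i ?l" "r j ?l" using upper i j by auto
  obtain m where m: "m \<in> I" "r ?l m" "r k m" using r_upper[OF l(1) k(1)] by blast
  show ?thesis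
    using equiv_trans[OF lift[OF l m(1,2)] equiv_sym[OF lift[OF k m(1,3)]]]
    by (simp add: add_def Let_def)
qed

lemma add_mono:
  assumes "below p p'" "below q q'" shows "below (add p q) (add p' q')"
proof -
  obtain i x i' x' j y j' y' where [simp]: "p = (i, x)" "p' = (i', x')" "q = (j, y)" "q' = (j', y')"
    by (metis surj_pair)
  have "i \<in> I" using assms by (simp add: below_def pairs_def)
  obtain a where a: "i \<in> I" "i' \<in> I" "a \<in> I" "x \<in> carrier (G i)" "x' \<in> carrier (G i')"
    "r i a" "r i' a" "\<phi> i a x \<lless>\<^bsub>G a\<^esub> \<phi> i' a x'"
    using belowE[of i x i' x' i] assms(1) \<open>i \<in> I\<close> by auto
  obtain b where b: "j \<in> I" "j' \<in> I" "b \<in> I" "y \<in> carrier (G j)" "y' \<in> carrier (G j')"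
    "r j b" "r j' b" "r a b" "\<phi> j b y \<lless>\<^bsub>G b\<^esub> \<phi> j' b y'"
    using belowE[of j y j' y' a] assms(2) a(3) by auto
  interpret Gb: Cu_semigroup "G b" using Cu_G b(3) .
  have ib: "r i b" "r i' b" using a b r_trans by blast+
  have "\<phi> i b x \<lless>\<^bsub>G b\<^esub> \<phi> i' b x'" using way_below_later[of a i x i' x' b] a b by blast
  then have "\<phi> i b x \<otimes>\<^bsub>G b\<^esub> \<phi> j b y \<lless>\<^bsub>G b\<^esub> \<phi> i' b x' \<otimes>\<^bsub>G b\<^esub> \<phi> j' b y'"
    using b(9) by (rule Gb.O3)
  then have "below (b, \<phi> i b x \<otimes>\<^bsub>G b\<^esub> \<phi> j b y) (b, \<phi> i' b x' \<otimes>\<^bsub>G b\<^esub> \<phi> j' b y')"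
    using b(3) below_same_index by blast
  moreover have "equiv (add p q) (b, \<phi> i b x \<otimes>\<^bsub>G b\<^esub> \<phi> j b y)"
    "equiv (add p' q') (b, \<phi> i' b x' \<otimes>\<^bsub>G b\<^esub> \<phi> j' b y')"
    using equiv_add a b ib by auto
  ultimately show ?thesis by (metis equivD)
qed

lemma equiv_add_commute:
  assumes "p \<in> pairs" "q \<in> pairs" shows "equiv (add p q) (add q p)"
proof -
  obtain i x j y where pq: "p = (i, x)" "i \<in> I" "x \<in> carrier (G i)" "q = (j, y)" "j \<in> I" "y \<in> carrier (G j)"
    using assms by (auto simp: pairs_def)
  obtain k where k: "k \<in> I" "r i k" "r j k" using r_upper pq by blast
  interpret Gk: Cu_semigroup "G k" using Cu_G k(1) .
  have "\<phi> i k x \<otimes>\<^bsub>G k\<^esub> \<phi> j k y = \<phi> j k y \<otimes>\<^bsub>G k\<^esub> \<phi> i k x"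
    using pq k \<phi>_in Gk.m_comm by blast
  then show ?thesis
    using equiv_add[of i x j y k] equiv_add[of j y i x k] pq k by (simp add: equiv_def)
qed

lemma equiv_add_assoc:
  assumes "p \<in> pairs" "q \<in> pairs" "s \<in> pairs"
  shows "equiv (add (add p q) s) (add p (add q s))"
proof -
  obtain i x j y h z where pq: "p = (i, x)" "i \<in> I" "x \<in> carrier (G i)"
    "q = (j, y)" "j \<in> I" "y \<in> carrier (G j)" "s = (h, z)" "h \<in> I" "z \<in> carrier (G h)"
    using assms by (auto simp: pairs_def)
  define a b where "a = upper i j" and "b = upper j h"
  have a: "a \<in> I" "r i a" "r j a" and b: "b \<in> I" "r j b" "r h b" using upper pq by (auto simp: a_def b_def)
  obtain k where k: "k \<in> I" "r a k" "r b k" using r_upper a b by blast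
  have ik: "r i k" "r j k" "r h k" using a b k pq r_trans by blast+
  interpret Gk: Cu_semigroup "G k" using Cu_G k(1) .
  define u v where "u = \<phi> i a x \<otimes>\<^bsub>G a\<^esub> \<phi> j a y" and "v = \<phi> j b y \<otimes>\<^bsub>G b\<^esub> \<phi> h b z"
  have add: "add p q = (a, u)" "add q s = (b, v)" using pq by (auto simp: add_def Let_def u_def v_def a_def b_def)
  have uv: "u \<in> carrier (G a)" "v \<in> carrier (G b)" using a b pq by (auto simp: u_def v_def intro!: m_closed_G \<phi>_in)
  have "\<phi> a k u = \<phi> i k x \<otimes>\<^bsub>G k\<^esub> \<phi> j k y" "\<phi> b k v = \<phi> j k y \<otimes>\<^bsub>G k\<^esub> \<phi> h k z"
    using a b k pq by (auto simp: u_def v_def \<phi>_mult \<phi>_in \<phi>_comp)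
  then have "\<phi> a k u \<otimes>\<^bsub>G k\<^esub> \<phi> h k z = \<phi> i k x \<otimes>\<^bsub>G k\<^esub> \<phi> b k v"
    using pq k ik by (simp add: Gk.m_assoc \<phi>_in)
  moreover have "equiv (add (a, u) s) (k, \<phi> a k u \<otimes>\<^bsub>G k\<^esub> \<phi> h k z)"
    using equiv_add[of a u h z k] a uv k ik pq by blast
  moreover have "equiv (add p (b, v)) (k, \<phi> i k x \<otimes>\<^bsub>G k\<^esub> \<phi> b k v)"
    using equiv_add[of i x b v k] b uv k ik pq by blast
  ultimately show ?thesis unfolding add by (simp add: equiv_def)
qed

lemma equiv_zero: "i \<in> I \<Longrightarrow> equiv zero (i, \<one>\<^bsub>G i\<^esub>)"
proof -
  assume i: "i \<in> I"
  define j where "j = (SOME i. i \<in> I)"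
  have j: "j \<in> I" using I_nonempty unfolding j_def by (simp add: some_in_eq)
  obtain k where k: "k \<in> I" "r i k" "r j k" using r_upper i j by blast
  interpret Gi: Cu_semigroup "G i" using Cu_G i .
  interpret Gj: Cu_semigroup "G j" using Cu_G j .
  have "equiv (j, \<one>\<^bsub>G j\<^esub>) (k, \<one>\<^bsub>G k\<^esub>)" "equiv (i, \<one>\<^bsub>G i\<^esub>) (k, \<one>\<^bsub>G k\<^esub>)"
    using equiv_lift[OF j k(1,3) Gj.one_closed] equiv_lift[OF i k(1,2) Gi.one_closed]
      Cu_morphismD(3)[OF \<phi>_morphism[OF j k(1,3)]] Cu_morphismD(3)[OF \<phi>_morphism[OF i k(1,2)]]
    by simp_all
  then show ?thesis by (simp add: zero_def Let_def j_def[symmetric] equiv_def)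
qed

lemma zero_in_pairs: "zero \<in> pairs"
proof -
  have "(SOME i. i \<in> I) \<in> I" using I_nonempty by (simp add: some_in_eq)
  then interpret Cu_semigroup "G (SOME i. i \<in> I)" by (rule Cu_G)
  show ?thesis using \<open>(SOME i. i \<in> I) \<in> I\<close> by (simp add: zero_def Let_def pairs_def)
qed

lemma zero_below: "p \<in> pairs \<Longrightarrow> below zero p"
proof -
  assume "p \<in> pairs"
  then obtain i x where p: "p = (i, x)" "i \<in> I" "x \<in> carrier (G i)" by (auto simp: pairs_def)
  interpret Cu_semigroup "G i" using Cu_G p(2) .
  have "below (i, \<one>\<^bsub>G i\<^esub>) p" using below_same_index[OF p(2) one_way_below[OF p(3)]] p by simp
  then show ?thesis using equivD[OF equiv_zero[OF p(2)]] by blast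
qed

lemma equiv_add_zero:
  assumes "p \<in> pairs" shows "equiv (add zero p) p"
proof -
  obtain i x j z where p: "p = (i, x)" "i \<in> I" "x \<in> carrier (G i)"
    and z: "zero = (j, z)" "j \<in> I" "z \<in> carrier (G j)" "z = \<one>\<^bsub>G j\<^esub>"
    using assms zero_in_pairs by (auto simp: pairs_def zero_def Let_def)
  obtain k where k: "k \<in> I" "r i k" "r j k" using r_upper p z by blast
  interpret Gk: Cu_semigroup "G k" using Cu_G k(1) .
  have "\<phi> j k z \<otimes>\<^bsub>G k\<^esub> \<phi> i k x = \<phi> i k x"
    using Cu_morphismD(3)[OF \<phi>_morphism[OF z(2) k(1,3)]] z(4) p k by (simp add: \<phi>_in)
  then show ?thesis
    using equiv_add[of j z i x k] equiv_lift[of i k x] p z k by (simp add: equiv_def)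
qed

sublocale rounded_basis pairs below add zero
proof
  show "p \<in> pairs \<and> q \<in> pairs" if "below p q" for p q using that by (simp add: below_def)
  show "below p s" if "below p q" "below q s" for p q s using that by (rule below_trans)
  show "\<exists>s. (\<forall>n::nat. below (s n) (s (Suc n))) \<and> (\<forall>n. below (s n) p) \<and>
      (\<forall>q. below q p \<longrightarrow> (\<exists>n. below q (s n)))" if "p \<in> pairs" for p
    using that by (rule below_rounded)
  show "below (add p q) (add p' q')" if "below p p'" "below q q'" for p p' q q'
    using that by (rule add_mono)
  show "below w (add q p)" if "below w (add p q)" "p \<in> pairs" "q \<in> pairs" for w p q
    using that equivD(1)[OF equiv_add_commute] by blast
  show "below w (add (add p q) s) \<longleftrightarrow> below w (add p (add q s))"
    if "p \<in> pairs" "q \<in> pairs" "s \<in> pairs" for w p q s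
    using that by (intro equivD(1) equiv_add_assoc)
  show "below w (add zero p) \<longleftrightarrow> below w p" if "p \<in> pairs" for w p
    using that by (intro equivD(1) equiv_add_zero)
qed (fact zero_in_pairs zero_below)+

text \<open>
  Additivity is the least direct property: an element below \<open>x \<otimes> y\<close> is, by (O4), already below the sum
  of two terms of \<open>\<lless>\<close>-increasing sequences for \<open>x\<close> and \<open>y\<close>, and those terms belong to the two
  principal ideals.
\<close>

lemma cocone_completion: "Cu_cocone I r G \<phi> completion (\<lambda>i x. down (i, x))"
  unfolding Cu_cocone_def
proof (intro conjI ballI impI Cu_semigroup_completion)
  fix i j x assume "i \<in> I" "j \<in> I" "r i j" "x \<in> carrier (G i)"
  then have "equiv (i, x) (j, \<phi> i j x)" by (rule equiv_lift)
  then show "down (j, \<phi> i j x) = down (i, x)" by (simp add: down_def equivD)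
next
  fix i assume i: "i \<in> I"
  interpret Gi: Cu_semigroup "G i" using Cu_G i .
  have pair: "(i, x) \<in> pairs" if "x \<in> carrier (G i)" for x using that i by (simp add: pairs_def)
  have mono: "down (i, x) \<subseteq> down (i, y)"
    if xy: "x \<in> carrier (G i)" "y \<in> carrier (G i)" "x \<preceq>\<^bsub>G i\<^esub> y" for x y
  proof
    fix w assume "w \<in> down (i, x)"
    then have w: "below w (i, x)" by (simp add: in_down)
    obtain j z where [simp]: "w = (j, z)" by (metis surj_pair)
    obtain k where k: "j \<in> I" "k \<in> I" "z \<in> carrier (G j)" "r j k" "r i k"
      "\<phi> j k z \<lless>\<^bsub>G k\<^esub> \<phi> i k x"
      using belowE[of j z i x i] w i by auto
    interpret Gk: Cu_semigroup "G k" using Cu_G k(2) .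
    have "\<phi> j k z \<lless>\<^bsub>G k\<^esub> \<phi> i k y"
      using k(6) Cu_morphismD(4)[OF \<phi>_morphism[OF i k(2,5)] xy] \<phi>_in[OF i k(2,5) xy(2)]
      by (rule Gk.way_below_le_trans)
    then show "w \<in> down (i, y)" using k i xy by (auto simp: in_down intro!: belowI[of j i k])
  qed
  have equiv_mult: "equiv (add (i, x) (i, y)) (i, x \<otimes>\<^bsub>G i\<^esub> y)"
    if "x \<in> carrier (G i)" "y \<in> carrier (G i)" for x y
    using equiv_add[of i x i y i] that i r_refl by (simp add: \<phi>_id)
  have sup: "down (i, x) = (\<Union>n. down (i, f n))" "increasing_seq completion (\<lambda>n. down (i, f n))"
    if f: "increasing_seq (G i) f" "is_seq_sup (G i) f x" for f x
  proof -
    have fx: "f n \<in> carrier (G i)" "x \<in> carrier (G i)" for n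
      using Gi.increasing_seq_in[OF f(1)] Gi.seq_sup_in[OF f(2)] by auto
    have "down (i, x) \<subseteq> (\<Union>n. down (i, f n))" using below_sup[OF _ f] by (auto simp: in_down)
    moreover have "down (i, f n) \<subseteq> down (i, x)" for n
      using mono[OF fx] Gi.seq_sup_upper[OF f(2)] by blast
    ultimately show "down (i, x) = (\<Union>n. down (i, f n))" by blast
    show "increasing_seq completion (\<lambda>n. down (i, f n))"
      using mono fx f(1) pair down_ideal by (simp add: increasing_completion increasing_seq_def)
  qed
  show "(\<lambda>x. down (i, x)) \<in> Cu_morphisms (G i) completion"
  proof (rule Cu_morphismI)
    fix x assume "x \<in> carrier (G i)"
    then show "down (i, x) \<in> carrier completion" using pair down_ideal by simp
  next
    show "down (i, \<one>\<^bsub>G i\<^esub>) = \<one>\<^bsub>completion\<^esub>"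
      using equivD[OF equiv_zero[OF i]] by (simp add: down_def)
  next
    fix x y assume "x \<in> carrier (G i)" "y \<in> carrier (G i)" "x \<preceq>\<^bsub>G i\<^esub> y"
    then show "down (i, x) \<preceq>\<^bsub>completion\<^esub> down (i, y)" using mono by simp
  next
    fix f x assume f: "increasing_seq (G i) f" "is_seq_sup (G i) f x"
    show "is_seq_sup completion (\<lambda>n. down (i, f n)) (down (i, x))"
      using sup[OF f] seq_sup_completion by blast
  next
    fix x y assume xy: "x \<lless>\<^bsub>G i\<^esub> y"
    then have "(i, x) \<in> down (i, y)" using below_same_index[OF i] by (simp add: in_down)
    then show "down (i, x) \<lless>\<^bsub>completion\<^esub> down (i, y)"
      using Gi.way_below_in[OF xy] pair down_ideal unfolding way_below_completion by blast
  next
    fix x y assume xy: "x \<in> carrier (G i)" "y \<in> carrier (G i)"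
    show "down (i, x \<otimes>\<^bsub>G i\<^esub> y) = down (i, x) \<otimes>\<^bsub>completion\<^esub> down (i, y)"
    proof (intro equalityI subsetI)
      fix w assume "w \<in> down (i, x \<otimes>\<^bsub>G i\<^esub> y)"
      then have w: "below w (i, x \<otimes>\<^bsub>G i\<^esub> y)" by (simp add: in_down)
      obtain f where f: "\<And>n. f n \<lless>\<^bsub>G i\<^esub> f (Suc n)" "is_seq_sup (G i) f x" using Gi.O2 xy(1) by blast
      obtain g where g: "\<And>n. g n \<lless>\<^bsub>G i\<^esub> g (Suc n)" "is_seq_sup (G i) g y" using Gi.O2 xy(2) by blast
      have incs: "increasing_seq (G i) f" "increasing_seq (G i) g"
        using Gi.way_below_chain_increasing f(1) g(1) by auto
      have "increasing_seq (G i) (\<lambda>n. f n \<otimes>\<^bsub>G i\<^esub> g n)"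
        using f(1) g(1) Gi.O3 by (intro Gi.way_below_chain_increasing) blast
      then obtain n where "below w (i, f n \<otimes>\<^bsub>G i\<^esub> g n)"
        using below_sup[OF w _ Gi.O4[OF incs f(2) g(2)]] by blast
      then have "below w (add (i, f n) (i, g n))"
        using equivD(1)[OF equiv_mult] Gi.increasing_seq_in[OF incs(1)] Gi.increasing_seq_in[OF incs(2)]
        by simp
      moreover have "(i, f n) \<in> down (i, x)" "(i, g n) \<in> down (i, y)"
        using below_same_index[OF i] Gi.way_below_chain_sup[OF f] Gi.way_below_chain_sup[OF g]
        by (auto simp: in_down)
      ultimately show "w \<in> down (i, x) \<otimes>\<^bsub>completion\<^esub> down (i, y)"
        unfolding mult_completion by blast
    next
      fix w assume "w \<in> down (i, x) \<otimes>\<^bsub>completion\<^esub> down (i, y)"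
      then obtain u v where "below u (i, x)" "below v (i, y)" "below w (add u v)"
        by (auto simp: mult_completion in_down)
      then have "below w (add (i, x) (i, y))" using add_mono below_trans by blast
      then show "w \<in> down (i, x \<otimes>\<^bsub>G i\<^esub> y)" using equivD(1)[OF equiv_mult[OF xy]] by (simp add: in_down)
    qed
  qed
qed

lemma limit_universal:
  fixes T :: "('i \<times> 'a) set ordered_monoid"
  assumes "is_Cu_limit I r G \<phi> S \<sigma>" "Cu_cocone I r G \<phi> T \<tau>"
  shows "\<exists>u\<in>Cu_morphisms S T. \<forall>i\<in>I. \<forall>x\<in>carrier (G i). u (\<sigma> i x) = \<tau> i x"
proof -
  have "\<exists>u\<in>Cu_morphisms S T. (\<forall>i\<in>I. \<forall>x\<in>carrier (G i). u (\<sigma> i x) = \<tau> i x) \<and>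
           (\<forall>v\<in>Cu_morphisms S T. (\<forall>i\<in>I. \<forall>x\<in>carrier (G i). v (\<sigma> i x) = \<tau> i x) \<longrightarrow>
              (\<forall>x\<in>carrier S. v x = u x))"
    using assms by (simp add: is_Cu_limit_def)
  then show ?thesis by blast
qed

lemma limit_unique:
  fixes T :: "('i \<times> 'a) set ordered_monoid"
  assumes "is_Cu_limit I r G \<phi> S \<sigma>" "Cu_cocone I r G \<phi> T \<tau>"
    and "v \<in> Cu_morphisms S T" "w \<in> Cu_morphisms S T"
    and "\<forall>i\<in>I. \<forall>x\<in>carrier (G i). v (\<sigma> i x) = \<tau> i x"
    and "\<forall>i\<in>I. \<forall>x\<in>carrier (G i). w (\<sigma> i x) = \<tau> i x"
  shows "\<forall>x\<in>carrier S. v x = w x"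
proof -
  obtain u where u: "\<forall>v\<in>Cu_morphisms S T. (\<forall>i\<in>I. \<forall>x\<in>carrier (G i). v (\<sigma> i x) = \<tau> i x) \<longrightarrow>
              (\<forall>x\<in>carrier S. v x = u x)"
  proof -
    have "\<exists>u\<in>Cu_morphisms S T. (\<forall>i\<in>I. \<forall>x\<in>carrier (G i). u (\<sigma> i x) = \<tau> i x) \<and>
           (\<forall>v\<in>Cu_morphisms S T. (\<forall>i\<in>I. \<forall>x\<in>carrier (G i). v (\<sigma> i x) = \<tau> i x) \<longrightarrow>
              (\<forall>x\<in>carrier S. v x = u x))"
      using assms(1,2) by (simp add: is_Cu_limit_def)
    then show thesis using that by (elim bexE conjE)
  qed
  show ?thesis using u[rule_format, OF assms(3) assms(5)[rule_format]]
      u[rule_format, OF assms(4) assms(6)[rule_format]] by simp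
qed

text \<open>
  The comparison map to the completion is monotone, so \<open>\<sigma> i a \<preceq> \<sigma> i b\<close> becomes an inclusion of
  the principal ideals of \<open>(i, a)\<close> and \<open>(i, b)\<close>, and \<open>(i, a')\<close> is a member of the smaller one.
\<close>

lemma limit_reflects_order:
  assumes lim: "is_Cu_limit I r G \<phi> S \<sigma>" and i: "i \<in> I"
    and ab: "a' \<lless>\<^bsub>G i\<^esub> a" "b \<in> carrier (G i)" "\<sigma> i a \<preceq>\<^bsub>S\<^esub> \<sigma> i b"
  shows "\<exists>k\<in>I. r i k \<and> \<phi> i k a' \<lless>\<^bsub>G k\<^esub> \<phi> i k b"
proof -
  interpret Gi: Cu_semigroup "G i" using Cu_G i .
  have a: "a \<in> carrier (G i)" using Gi.way_below_in[OF ab(1)] by simp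
  have "\<sigma> i \<in> Cu_morphisms (G i) S" using lim i by (simp add: is_Cu_limit_def Cu_cocone_def)
  note \<sigma>_in = Cu_morphismD(1)[OF this]
  obtain u where u: "u \<in> Cu_morphisms S completion"
    "\<And>i x. \<lbrakk>i \<in> I; x \<in> carrier (G i)\<rbrakk> \<Longrightarrow> u (\<sigma> i x) = down (i, x)"
    using limit_universal[OF lim cocone_completion] by blast
  have "down (i, a) \<subseteq> down (i, b)"
    using Cu_morphismD(4)[OF u(1) \<sigma>_in[OF a] \<sigma>_in[OF ab(2)] ab(3)] u(2)[OF i a] u(2)[OF i ab(2)]
    by simp
  moreover have "(i, a') \<in> down (i, a)" using below_same_index[OF i ab(1)] by (simp add: in_down)
  ultimately have "below (i, a') (i, b)" by (auto simp: in_down)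
  then show ?thesis using belowE[of i a' i b i] i by metis
qed

section \<open>Density of the images in an inductive limit\<close>

lemma cocone_images_sub_Cu:
  assumes co: "Cu_cocone I r G \<phi> T \<tau>"
  defines "M \<equiv> \<Union>i\<in>I. \<tau> i ` carrier (G i)"
  shows "M \<subseteq> way_below_closure T M" "sub_Cu_semigroup T (way_below_closure T M)"
proof -
  interpret T: Cu_semigroup T using co by (simp add: Cu_cocone_def)
  have \<tau>: "\<tau> i \<in> Cu_morphisms (G i) T" if "i \<in> I" for i using co that by (simp add: Cu_cocone_def)
  have comp: "\<tau> j (\<phi> i j x) = \<tau> i x" if "i \<in> I" "j \<in> I" "r i j" "x \<in> carrier (G i)" for i j x
    using co that by (simp add: Cu_cocone_def)
  show cl: "M \<subseteq> way_below_closure T M"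
  proof
    fix y assume "y \<in> M"
    then obtain i x where x: "i \<in> I" "x \<in> carrier (G i)" "y = \<tau> i x" by (auto simp: M_def)
    interpret Gi: Cu_semigroup "G i" using Cu_G x(1) .
    obtain f where f: "\<And>n. f n \<lless>\<^bsub>G i\<^esub> f (Suc n)" "is_seq_sup (G i) f x" using Gi.O2 x(2) by blast
    have inc: "increasing_seq (G i) f" using f(1) by (rule Gi.way_below_chain_increasing)
    have "range (\<lambda>n. \<tau> i (f n)) \<subseteq> M" using x(1) Gi.increasing_seq_in[OF inc] by (auto simp: M_def)
    moreover have "is_seq_sup T (\<lambda>n. \<tau> i (f n)) y"
      using Cu_morphismD(5)[OF \<tau>[OF x(1)] inc f(2)] x(3) by simp
    moreover have "\<tau> i (f n) \<lless>\<^bsub>T\<^esub> \<tau> i (f (Suc n))" for n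
      using Cu_morphismD(6)[OF \<tau>[OF x(1)] f(1)] .
    ultimately show "y \<in> way_below_closure T M"
      unfolding way_below_closure_def by (intro CollectI exI[of _ "\<lambda>n. \<tau> i (f n)"]) blast
  qed
  have step: "\<tau> i ` carrier (G i) \<subseteq> \<tau> k ` carrier (G k)" if "i \<in> I" "k \<in> I" "r i k" for i k
  proof
    fix y assume "y \<in> \<tau> i ` carrier (G i)"
    then obtain x where "x \<in> carrier (G i)" "y = \<tau> i x" by blast
    then have "y = \<tau> k (\<phi> i k x)" "\<phi> i k x \<in> carrier (G k)" using that comp \<phi>_in by auto
    then show "y \<in> \<tau> k ` carrier (G k)" by blast
  qed
  have "submonoid (\<Union>((\<lambda>i. \<tau> i ` carrier (G i)) ` I)) T"
  proof (rule directed_Union_submonoid)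
    show "directed_on ((\<lambda>i. \<tau> i ` carrier (G i)) ` I) (\<subseteq>)"
      unfolding directed_on_def
    proof (intro conjI ballI)
      fix A B assume "A \<in> (\<lambda>i. \<tau> i ` carrier (G i)) ` I" "B \<in> (\<lambda>i. \<tau> i ` carrier (G i)) ` I"
      then obtain i j where ij: "i \<in> I" "j \<in> I" "A = \<tau> i ` carrier (G i)" "B = \<tau> j ` carrier (G j)"
        by blast
      then obtain k where k: "k \<in> I" "r i k" "r j k" using r_upper by blast
      then have "A \<subseteq> \<tau> k ` carrier (G k)" "B \<subseteq> \<tau> k ` carrier (G k)" using ij step by auto
      then show "\<exists>k\<in>(\<lambda>i. \<tau> i ` carrier (G i)) ` I. A \<subseteq> k \<and> B \<subseteq> k" using k(1) by blast
    qed (use I_nonempty in \<open>auto intro: reflp_onI transp_onI\<close>)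
  next
    fix E assume "E \<in> (\<lambda>i. \<tau> i ` carrier (G i)) ` I"
    then obtain i where i: "i \<in> I" "E = \<tau> i ` carrier (G i)" by blast
    interpret Gi: Cu_semigroup "G i" using Cu_G i(1) .
    note \<tau>i = Cu_morphismD(1-3)[OF \<tau>[OF i(1)]]
    show "submonoid E T"
    proof (rule submonoid.intro)
      show "E \<subseteq> carrier T" using \<tau>i(1) i by blast
      show "\<one>\<^bsub>T\<^esub> \<in> E" using \<tau>i(3) Gi.one_closed i by (metis image_eqI)
      show "x \<otimes>\<^bsub>T\<^esub> y \<in> E" if "x \<in> E" "y \<in> E" for x y
        using that \<tau>i(2) Gi.m_closed i(2) by (auto simp flip: \<tau>i(2))
    qed
  qed
  then show "sub_Cu_semigroup T (way_below_closure T M)"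
    using T.sub_Cu_way_below_closure[OF _ cl] by (simp add: M_def)
qed

text \<open>
  Let \<open>H\<close> be the closure of the images in a copy of \<open>S\<close>. The universal map \<open>u\<close> from \<open>S\<close> to \<open>H\<close>
  and the isomorphism \<open>e\<close> from \<open>S\<close> onto the copy are two morphisms into the copy that agree on the
  images, hence are equal. So \<open>e\<close> takes values in \<open>H\<close>, which says that the images are dense.
\<close>

lemma limit_dense:
  assumes lim: "is_Cu_limit I r G \<phi> S \<sigma>"
  shows "carrier S \<subseteq> way_below_closure S (\<Union>i\<in>I. \<sigma> i ` carrier (G i))"
proof -
  have co: "Cu_cocone I r G \<phi> S \<sigma>" using lim by (simp add: is_Cu_limit_def)
  interpret S: Cu_semigroup S using co by (simp add: Cu_cocone_def)
  have \<sigma>: "\<sigma> i \<in> Cu_morphisms (G i) S" if "i \<in> I" for i using co that by (simp add: Cu_cocone_def)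
  define i\<^sub>0 where "i\<^sub>0 = (SOME i. i \<in> I)"
  define e :: "'a \<Rightarrow> ('i \<times> 'a) set" where "e s = {(i\<^sub>0, s)}" for s
  interpret e: Cu_transport S e by unfold_locales (simp add: e_def inj_on_def)
  let ?C = "transport e S"
  define \<tau> where "\<tau> i x = e (\<sigma> i x)" for i x
  have "(\<lambda>x. e (\<sigma> i x)) \<in> Cu_morphisms (G i) ?C" if "i \<in> I" for i
    using Cu_morphism_comp[OF \<sigma>[OF that] e.transport_morphism] .
  then have coC: "Cu_cocone I r G \<phi> ?C \<tau>"
    using e.Cu_semigroup_transport co by (simp add: Cu_cocone_def \<tau>_def[abs_def])
  define M where "M = (\<Union>i\<in>I. \<tau> i ` carrier (G i))"
  define H where "H = way_below_closure ?C M"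
  have MH: "M \<subseteq> H" and H: "sub_Cu_semigroup ?C H"
    using cocone_images_sub_Cu[OF coC] by (auto simp: M_def H_def)
  have "\<tau> i \<in> Cu_morphisms (G i) (?C\<lparr>carrier := H\<rparr>)" if "i \<in> I" for i
  proof (rule Cu_morphism_corestrict[OF _ H _ Cu_G[OF that]])
    show "\<tau> i \<in> Cu_morphisms (G i) ?C" using coC that by (simp add: Cu_cocone_def)
    show "\<tau> i x \<in> H" if "x \<in> carrier (G i)" for x using that \<open>i \<in> I\<close> MH by (auto simp: M_def)
  qed
  then have "Cu_cocone I r G \<phi> (?C\<lparr>carrier := H\<rparr>) \<tau>"
    using coC sub_Cu_semigroupD(2)[OF H] by (simp add: Cu_cocone_def)
  from limit_universal[OF lim this] obtain u where u: "u \<in> Cu_morphisms S (?C\<lparr>carrier := H\<rparr>)"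
    "\<forall>i\<in>I. \<forall>x\<in>carrier (G i). u (\<sigma> i x) = \<tau> i x"
    by (elim bexE conjE)
  have "u \<in> Cu_morphisms S ?C"
    using Cu_morphism_comp[OF u(1), of "\<lambda>x. x" ?C] H by (simp add: sub_Cu_semigroup_def)
  moreover have "\<forall>i\<in>I. \<forall>x\<in>carrier (G i). e (\<sigma> i x) = \<tau> i x" by (simp add: \<tau>_def)
  ultimately have eu: "\<forall>x\<in>carrier S. e x = u x"
    using limit_unique[OF lim coC e.transport_morphism] u(2) by blast
  show ?thesis
  proof
    fix x assume x: "x \<in> carrier S"
    have "e x \<in> H" using eu x Cu_morphismD(1)[OF u(1) x] by simp
    then obtain f where f: "range f \<subseteq> M" "\<And>n. f n \<lless>\<^bsub>?C\<^esub> f (Suc n)" "is_seq_sup ?C f (e x)"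
      by (auto simp: H_def way_below_closure_def)
    have "e.d (f n) \<in> (\<Union>i\<in>I. \<sigma> i ` carrier (G i))" for n
    proof -
      have "f n \<in> M" using f(1) by blast
      then obtain i z where "i \<in> I" "z \<in> carrier (G i)" "f n = e (\<sigma> i z)"
        by (auto simp: M_def \<tau>_def)
      then show ?thesis using Cu_morphismD(1)[OF \<sigma>] by auto
    qed
    moreover have "e.d (f n) \<lless>\<^bsub>S\<^esub> e.d (f (Suc n))" for n using f(2) by (simp add: e.way_below_transport)
    moreover have "is_seq_sup S (\<lambda>n. e.d (f n)) x" using f(3) x by (simp add: e.seq_sup_transport)
    ultimately show "x \<in> way_below_closure S (\<Union>i\<in>I. \<sigma> i ` carrier (G i))"
      unfolding way_below_closure_def by (intro CollectI exI[of _ "\<lambda>n. e.d (f n)"]) blast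
  qed
qed

section \<open>Comparison in inductive limits\<close>

text \<open>
  The element \<open>x\<close> is approximated twice. Since \<open>f k \<lless> x\<close>, each hypothesis survives for \<open>f k\<close>
  when \<open>y j\<close>, a supremum of elements of the images, is replaced by one of these. Terms way below a
  preimage \<open>a\<close> of \<open>f k\<close> let the resulting inequalities be pulled back to a member of the system.
\<close>

lemma m_comparison_limit:
  assumes lim: "is_Cu_limit I r G \<phi> S \<sigma>" and comp: "\<And>i. i \<in> I \<Longrightarrow> m_comparison m (G i)"
  shows "m_comparison m S"
  unfolding m_comparison_def
proof (intro ballI impI)
  have co: "Cu_cocone I r G \<phi> S \<sigma>" using lim by (simp add: is_Cu_limit_def)
  interpret S: Cu_semigroup S using co by (simp add: Cu_cocone_def)
  have \<sigma>: "\<sigma> i \<in> Cu_morphisms (G i) S" if "i \<in> I" for i using co that by (simp add: Cu_cocone_def)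
  have \<sigma>\<phi>: "\<sigma> j (\<phi> i j z) = \<sigma> i z" if "i \<in> I" "j \<in> I" "r i j" "z \<in> carrier (G i)" for i j z
    using co that by (simp add: Cu_cocone_def)
  note \<sigma>_in = Cu_morphismD(1)[OF \<sigma>]
  fix x y assume x: "x \<in> carrier S" and y: "y \<in> {..m} \<rightarrow> carrier S"
    and less: "\<forall>j\<le>m. stably_less S x (y j)"
  have yS: "y j \<in> carrier S" if "j \<le> m" for j using y that by auto
  obtain n :: "nat \<Rightarrow> nat" where n: "x [^]\<^bsub>S\<^esub> (n j + 1) \<preceq>\<^bsub>S\<^esub> y j [^]\<^bsub>S\<^esub> n j" if "j \<le> m" for j
    using less unfolding stably_less_def by metis
  have fin_S: "finprod S y {..m} \<in> carrier S" using y by (rule S.finprod_closed)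
  let ?M = "\<Union>i\<in>I. \<sigma> i ` carrier (G i)"
  obtain f where f: "range f \<subseteq> ?M" "\<And>k. f k \<lless>\<^bsub>S\<^esub> f (Suc k)" "is_seq_sup S f x"
    using limit_dense[OF lim] x unfolding way_below_closure_def by blast
  have "f k \<preceq>\<^bsub>S\<^esub> finprod S y {..m}" for k
  proof -
    have "f k \<in> ?M" using f(1) by blast
    then obtain i a\<^sub>0 where a\<^sub>0: "i \<in> I" "a\<^sub>0 \<in> carrier (G i)" "f k = \<sigma> i a\<^sub>0" by blast
    have fk: "f k \<lless>\<^bsub>S\<^esub> x" using f(2,3) by (rule S.way_below_chain_sup)
    have "\<exists>p b. p \<in> I \<and> b \<in> carrier (G p) \<and> \<sigma> p b \<preceq>\<^bsub>S\<^esub> y j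
        \<and> f k [^]\<^bsub>S\<^esub> (n j + 1) \<preceq>\<^bsub>S\<^esub> \<sigma> p b [^]\<^bsub>S\<^esub> n j" if j: "j \<le> m" for j
    proof -
      obtain g where g: "range g \<subseteq> ?M" "\<And>l. g l \<lless>\<^bsub>S\<^esub> g (Suc l)" "is_seq_sup S g (y j)"
        using limit_dense[OF lim] yS[OF j] unfolding way_below_closure_def by blast
      have inc: "increasing_seq S g" using g(2) by (rule S.way_below_chain_increasing)
      obtain l where l: "f k [^]\<^bsub>S\<^esub> (n j + 1) \<preceq>\<^bsub>S\<^esub> g l [^]\<^bsub>S\<^esub> n j"
        using S.way_belowD[OF S.pow_way_below[OF fk] S.pow_increasing[OF inc]
            S.pow_seq_sup[OF inc g(3)] n[OF j]] by blast
      have "g l \<in> ?M" using g(1) by blast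
      then obtain p b where "p \<in> I" "b \<in> carrier (G p)" "g l = \<sigma> p b" by blast
      then show ?thesis using l S.seq_sup_upper[OF g(3)] by metis
    qed
    then obtain p b where p: "\<And>j. j \<le> m \<Longrightarrow> p j \<in> I" and b: "\<And>j. j \<le> m \<Longrightarrow> b j \<in> carrier (G (p j))"
      and b_le: "\<And>j. j \<le> m \<Longrightarrow> \<sigma> (p j) (b j) \<preceq>\<^bsub>S\<^esub> y j"
      and bf: "\<And>j. j \<le> m \<Longrightarrow> f k [^]\<^bsub>S\<^esub> (n j + 1) \<preceq>\<^bsub>S\<^esub> \<sigma> (p j) (b j) [^]\<^bsub>S\<^esub> n j"
      by metis
    \<comment> \<open>All the elements chosen so far are moved into one member \<open>G l\<close>.\<close>
    have "insert i (p ` {..m}) \<subseteq> I" using a\<^sub>0(1) p by auto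
    then obtain l where l: "l \<in> I" "r i l" "\<And>j. j \<le> m \<Longrightarrow> r (p j) l"
      using finite_upper[of "insert i (p ` {..m})"] by auto
    define a where "a = \<phi> i l a\<^sub>0"
    define c where "c j = \<phi> (p j) l (b j)" for j
    interpret Gl: Cu_semigroup "G l" using Cu_G l(1) .
    have a: "a \<in> carrier (G l)" "\<sigma> l a = f k"
      using a\<^sub>0 l \<phi>_in \<sigma>\<phi> by (auto simp: a_def)
    have c: "c j \<in> carrier (G l)" "\<sigma> l (c j) = \<sigma> (p j) (b j)" if "j \<le> m" for j
      using that p b l \<phi>_in \<sigma>\<phi> by (auto simp: c_def)
    obtain g where g: "\<And>s. g s \<lless>\<^bsub>G l\<^esub> g (Suc s)" "is_seq_sup (G l) g a" using Gl.O2 a(1) by blast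
    have incg: "increasing_seq (G l) g" using g(1) by (rule Gl.way_below_chain_increasing)
    have "\<sigma> l (g s) \<preceq>\<^bsub>S\<^esub> finprod S y {..m}" for s
    proof -
      have gs: "g s \<in> carrier (G l)" "g s \<lless>\<^bsub>G l\<^esub> a"
        using Gl.increasing_seq_in[OF incg] Gl.way_below_chain_sup[OF g] by auto
      have "\<exists>q\<in>I. r l q \<and> \<phi> l q (g s [^]\<^bsub>G l\<^esub> (n j + 1)) \<preceq>\<^bsub>G q\<^esub> \<phi> l q (c j [^]\<^bsub>G l\<^esub> n j)"
        if j: "j \<le> m" for j
      proof -
        have "\<sigma> l (a [^]\<^bsub>G l\<^esub> (n j + 1)) \<preceq>\<^bsub>S\<^esub> \<sigma> l (c j [^]\<^bsub>G l\<^esub> n j)"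
          using bf[OF j] a c[OF j] Cu_morphism_pow[OF Gl.Cu_semigroup_axioms \<sigma>[OF l(1)]] by metis
        then obtain q where q: "q \<in> I" "r l q"
          "\<phi> l q (g s [^]\<^bsub>G l\<^esub> (n j + 1)) \<lless>\<^bsub>G q\<^esub> \<phi> l q (c j [^]\<^bsub>G l\<^esub> n j)"
          using limit_reflects_order[OF lim l(1) Gl.pow_way_below[OF gs(2)]] c(1)[OF j]
            Gl.nat_pow_closed by blast
        interpret Gq: Cu_semigroup "G q" using Cu_G q(1) .
        show ?thesis using q Gq.way_below_imp_le by blast
      qed
      then obtain q where q: "\<And>j. j \<le> m \<Longrightarrow> q j \<in> I" "\<And>j. j \<le> m \<Longrightarrow> r l (q j)"
        "\<And>j. j \<le> m \<Longrightarrow> \<phi> l (q j) (g s [^]\<^bsub>G l\<^esub> (n j + 1)) \<preceq>\<^bsub>G (q j)\<^esub> \<phi> l (q j) (c j [^]\<^bsub>G l\<^esub> n j)"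
        by metis
      \<comment> \<open>The \<open>m + 1\<close> inequalities hold at different stages \<open>q j\<close>; at \<open>t\<close> they hold together.\<close>
      have "insert l (q ` {..m}) \<subseteq> I" using l(1) q(1) by auto
      then obtain t where t: "t \<in> I" "r l t" "\<And>j. j \<le> m \<Longrightarrow> r (q j) t"
        using finite_upper[of "insert l (q ` {..m})"] by auto
      interpret Gt: Cu_semigroup "G t" using Cu_G t(1) .
      have less_t: "stably_less (G t) (\<phi> l t (g s)) (\<phi> l t (c j))" if j: "j \<le> m" for j
      proof -
        let ?u = "g s [^]\<^bsub>G l\<^esub> (n j + 1)" and ?v = "c j [^]\<^bsub>G l\<^esub> n j"
        have uv: "?u \<in> carrier (G l)" "?v \<in> carrier (G l)"
          using gs(1) c(1)[OF j] by (auto intro: Gl.nat_pow_closed)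
        have "\<phi> (q j) t (\<phi> l (q j) ?u) \<preceq>\<^bsub>G t\<^esub> \<phi> (q j) t (\<phi> l (q j) ?v)"
          using Cu_morphismD(4)[OF \<phi>_morphism[OF q(1)[OF j] t(1) t(3)[OF j]] _ _ q(3)[OF j]]
            \<phi>_in[OF l(1) q(1)[OF j] q(2)[OF j]] uv by blast
        then have "\<phi> l t ?u \<preceq>\<^bsub>G t\<^esub> \<phi> l t ?v"
          using \<phi>_comp[OF q(2)[OF j] t(3)[OF j] l(1) q(1)[OF j] t(1)] uv by simp
        then show ?thesis
          using Cu_morphism_pow[OF Gl.Cu_semigroup_axioms \<phi>_morphism[OF l(1) t(1,2)]] gs(1) c(1)[OF j]
          unfolding stably_less_def by metis
      qed
      have ct: "(\<lambda>j. \<phi> l t (c j)) \<in> {..m} \<rightarrow> carrier (G t)"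
        using c(1) \<phi>_in[OF l(1) t(1,2)] by auto
      have gt: "\<phi> l t (g s) \<in> carrier (G t)" using gs(1) \<phi>_in[OF l(1) t(1,2)] by blast
      have "\<phi> l t (g s) \<preceq>\<^bsub>G t\<^esub> finprod (G t) (\<lambda>j. \<phi> l t (c j)) {..m}"
        using comp[OF t(1), unfolded m_comparison_def, rule_format, OF gt ct less_t] .
      then have "\<sigma> t (\<phi> l t (g s)) \<preceq>\<^bsub>S\<^esub> \<sigma> t (finprod (G t) (\<lambda>j. \<phi> l t (c j)) {..m})"
        using Cu_morphismD(4)[OF \<sigma>[OF t(1)] gt Gt.finprod_closed[OF ct]] by blast
      then have le: "\<sigma> l (g s) \<preceq>\<^bsub>S\<^esub> finprod S (\<lambda>j. \<sigma> t (\<phi> l t (c j))) {..m}"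
        using Cu_morphism_finprod[OF Gt.Cu_semigroup_axioms S.Cu_semigroup_axioms \<sigma>[OF t(1)] ct]
          \<sigma>\<phi>[OF l(1) t(1,2) gs(1)] by simp
      have cS: "(\<lambda>j. \<sigma> t (\<phi> l t (c j))) \<in> {..m} \<rightarrow> carrier S" using ct \<sigma>_in[OF t(1)] by auto
      moreover have "\<sigma> t (\<phi> l t (c j)) \<preceq>\<^bsub>S\<^esub> y j" if "j \<le> m" for j
        using b_le[OF that] c[OF that] \<sigma>\<phi>[OF l(1) t(1,2)] by simp
      ultimately have "finprod S (\<lambda>j. \<sigma> t (\<phi> l t (c j))) {..m} \<preceq>\<^bsub>S\<^esub> finprod S y {..m}"
        using y by (intro S.finprod_mono)
      then show ?thesis
        using S.le_trans[OF le] \<sigma>_in[OF l(1) gs(1)] S.finprod_closed[OF cS] fin_S by blast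
    qed
    moreover have "is_seq_sup S (\<lambda>s. \<sigma> l (g s)) (f k)"
      using Cu_morphismD(5)[OF \<sigma>[OF l(1)] incg g(2)] a(2) by simp
    ultimately show ?thesis using S.seq_sup_least fin_S by blast
  qed
  then show "x \<preceq>\<^bsub>S\<^esub> finprod S y {..m}" using S.seq_sup_least[OF f(3) fin_S] by blast
qed

end

theorem proposition3p4:
  fixes m :: nat
  shows "separably_determined TYPE('i) (m_comparison m :: 'a ordered_monoid \<Rightarrow> bool)"
  unfolding separably_determined_def passes_to_inductive_limits_def
proof (intro conjI allI impI)
  show "Lowenheim_Skolem (m_comparison m :: 'a ordered_monoid \<Rightarrow> bool)"
    by (rule Lowenheim_Skolem_m_comparison)
next
  fix I :: "'i set" and r and G :: "'i \<Rightarrow> 'a ordered_monoid" and \<phi> S \<sigma>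
  assume *: "Cu_system I r G \<phi> \<and> is_Cu_limit I r G \<phi> S \<sigma> \<and> (\<forall>i\<in>I. m_comparison m (G i))"
  then interpret Cu_inductive_system I r G \<phi> by unfold_locales simp
  show "m_comparison m S" using m_comparison_limit * by blast
qed

end
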